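(* Let $X$ and $Y$ be uncountable compact metrizable spaces. Then the Fremlin tensor product $C(X)\bar{\otimes}C(Y)$ is not square mean complete. Therefore the vector space complexification $(C(X)\bar{\otimes}C(Y))_{\mathbb{C}}$ is not an Archimedean vector lattice over $\mathbb{C}$.
   Context: $C(X)$ denotes the Archimedean real vector lattice of real-valued continuous functions on $X$ with pointwise operations and order. A $\mathbb{R}$-linear map $T:E\to F$ of real vector lattices is a vector lattice homomorphism if $T(|f|)=|T(f)|$ for all $f$. A bilinear map $T:E_1\times E_2\to F$ of real vector lattices is a vector lattice bimorphism if $T(\cdot,f_2)$ and $T(f_1,\cdot)$ are vector lattice homomorphisms for all $f_1\in E_1^+$, $f_2\in E_2^+$. The Fremlin tensor product of Archimedean real vector lattices $E_1,E_2$ is the (essentially unique) pair $(E_1\bar\otimes E_2,\bar\otimes)$ of an Archimedean real vector lattice and a vector lattice bimorphism $\bar\otimes:E_1\times E_2\to E_1\bar\otimes E_2$ such that for every Archimedean real vector lattice $F$ and every vector lattice bimorphism $T:E_1\times E_2\to F$ there is a unique vector lattice homomorphism $T^{\bar\otimes}:E_1\bar\otimes E_2\to F$ with $T^{\bar\otimes}\circ\bar\otimes=T$. For $E_1=C(X)$, $E_2=C(Y)$ it may be identified with the vector sublattice of $C(X\times Y)$ generated by the algebraic tensor product $C(X)\otimes C(Y)$, where $f\otimes g$ is the function $(x,y)\mapsto f(x)g(y)$. An Archimedean real vector lattice $E$ is square mean complete if $f\boxplus g:=\sup\{f\cos\theta+g\sin\theta:\theta\in[0,2\pi]\}$ exists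 in $E$ for all $f,g\in E$. For a real vector space $V$, $V_{\mathbb{C}}:=V\oplus iV$ is its vector space complexification. A modulus on a complex vector space $E$ is a map $m:E\to E$ with $m\circ m=m$ such that (1) $m(\alpha f)=|\alpha|m(f)$ for $\alpha\in\mathbb{C}$, $f\in E$; (2) $m\bigl(m(m(f)+m(g))-m(f+g)\bigr)=m(f)+m(g)-m(f+g)$ for $f,g\in E$; (3) $E$ is the $\mathbb{C}$-linear hull of $m(E)$. It is Archimedean if, for $f,g\in E$, $m(m(g)-nm(f))=m(g)-nm(f)$ for all $n\in\mathbb{N}$ implies $f=0$. For an Archimedean real vector lattice $V$, the phrase "$V_{\mathbb{C}}$ is an Archimedean vector lattice over $\mathbb{C}$" means that $V_{\mathbb{C}}$ carries an Archimedean modulus $m$ whose range $m(V_{\mathbb{C}})$ is the positive cone $V^+$ of $V$. *)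

theory Defs
  imports "HOL-Analysis.Analysis"
begin

text \<open>
  Vector lattices are structures with an explicit carrier, because the universal property of the
  Fremlin tensor product quantifies over vector lattices. Operations and maps are only relevant on
  the carriers.
\<close>

record ('k, 'v) vspace =
  carr :: "'v set"
  add :: "'v \<Rightarrow> 'v \<Rightarrow> 'v"
  zer :: 'v
  scal :: "'k \<Rightarrow> 'v \<Rightarrow> 'v"

record 'v vlattice = "(real, 'v) vspace" +
  le :: "'v \<Rightarrow> 'v \<Rightarrow> bool"

definition sub :: "('k::field, 'v, 'm) vspace_scheme \<Rightarrow> 'v \<Rightarrow> 'v \<Rightarrow> 'v" where
  "sub E f g = add E f (scal E (- 1) g)"

locale vspace_on =
  fixes E :: "('k::field, 'v, 'm) vspace_scheme"
  assumes zer_closed: "zer E \<in> carr E"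
    and add_closed: "\<lbrakk>f \<in> carr E; g \<in> carr E\<rbrakk> \<Longrightarrow> add E f g \<in> carr E"
    and scal_closed: "f \<in> carr E \<Longrightarrow> scal E a f \<in> carr E"
    and add_assoc: "\<lbrakk>f \<in> carr E; g \<in> carr E; h \<in> carr E\<rbrakk>
          \<Longrightarrow> add E (add E f g) h = add E f (add E g h)"
    and add_commute: "\<lbrakk>f \<in> carr E; g \<in> carr E\<rbrakk> \<Longrightarrow> add E f g = add E g f"
    and add_zer: "f \<in> carr E \<Longrightarrow> add E f (zer E) = f"
    and sub_self: "f \<in> carr E \<Longrightarrow> sub E f f = zer E"
    and scal_add_right: "\<lbrakk>f \<in> carr E; g \<in> carr E\<rbrakk>
          \<Longrightarrow> scal E a (add E f g) = add E (scal E a f) (scal E a g)"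
    and scal_add_left: "f \<in> carr E \<Longrightarrow> scal E (a + b) f = add E (scal E a f) (scal E b f)"
    and scal_scal: "f \<in> carr E \<Longrightarrow> scal E a (scal E b f) = scal E (a * b) f"
    and scal_one: "f \<in> carr E \<Longrightarrow> scal E 1 f = f"

definition vsubspace :: "('k::field, 'v, 'm) vspace_scheme \<Rightarrow> 'v set \<Rightarrow> bool" where
  "vsubspace E W \<longleftrightarrow> W \<subseteq> carr E \<and> zer E \<in> W \<and>
     (\<forall>f\<in>W. \<forall>g\<in>W. add E f g \<in> W) \<and> (\<forall>a. \<forall>f\<in>W. scal E a f \<in> W)"

definition linear_hull :: "('k::field, 'v, 'm) vspace_scheme \<Rightarrow> 'v set \<Rightarrow> 'v set" where
  "linear_hull E S = \<Inter>{W. vsubspace E W \<and> S \<subseteq> W}"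

definition linear_map ::
  "('k::field, 'v, 'm) vspace_scheme \<Rightarrow> ('k, 'w, 'n) vspace_scheme \<Rightarrow> ('v \<Rightarrow> 'w) \<Rightarrow> bool" where
  "linear_map E F T \<longleftrightarrow> T \<in> carr E \<rightarrow> carr F \<and>
     (\<forall>f\<in>carr E. \<forall>g\<in>carr E. T (add E f g) = add F (T f) (T g)) \<and>
     (\<forall>a. \<forall>f\<in>carr E. T (scal E a f) = scal F a (T f))"


subsection \<open>Archimedean real vector lattices\<close>

definition is_sup :: "'v vlattice \<Rightarrow> 'v set \<Rightarrow> 'v \<Rightarrow> bool" where
  "is_sup E S s \<longleftrightarrow> s \<in> carr E \<and> (\<forall>f\<in>S. le E f s) \<and>
     (\<forall>u\<in>carr E. (\<forall>f\<in>S. le E f u) \<longrightarrow> le E s u)"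

definition is_inf :: "'v vlattice \<Rightarrow> 'v set \<Rightarrow> 'v \<Rightarrow> bool" where
  "is_inf E S s \<longleftrightarrow> s \<in> carr E \<and> (\<forall>f\<in>S. le E s f) \<and>
     (\<forall>u\<in>carr E. (\<forall>f\<in>S. le E u f) \<longrightarrow> le E u s)"

definition pos_cone :: "'v vlattice \<Rightarrow> 'v set" where
  "pos_cone E = {f \<in> carr E. le E (zer E) f}"

locale real_vector_lattice = vspace_on E for E :: "'v vlattice" +
  assumes le_refl: "f \<in> carr E \<Longrightarrow> le E f f"
    and le_trans: "\<lbrakk>f \<in> carr E; g \<in> carr E; h \<in> carr E; le E f g; le E g h\<rbrakk> \<Longrightarrow> le E f h"
    and le_antisym: "\<lbrakk>f \<in> carr E; g \<in> carr E; le E f g; le E g f\<rbrakk> \<Longrightarrow> f = g"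
    and add_mono: "\<lbrakk>f \<in> carr E; g \<in> carr E; h \<in> carr E; le E f g\<rbrakk>
          \<Longrightarrow> le E (add E f h) (add E g h)"
    and scal_mono: "\<lbrakk>f \<in> carr E; g \<in> carr E; le E f g; 0 \<le> a\<rbrakk>
          \<Longrightarrow> le E (scal E a f) (scal E a g)"
    and sup_exists: "\<lbrakk>f \<in> carr E; g \<in> carr E\<rbrakk> \<Longrightarrow> \<exists>s. is_sup E {f, g} s"
    and inf_exists: "\<lbrakk>f \<in> carr E; g \<in> carr E\<rbrakk> \<Longrightarrow> \<exists>s. is_inf E {f, g} s"

locale archimedean_vector_lattice = real_vector_lattice +
  assumes archimedean: "\<lbrakk>f \<in> pos_cone E; g \<in> pos_cone E; \<And>n::nat. le E (scal E (real n) f) g\<rbrakk>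
          \<Longrightarrow> f = zer E"

definition abs_val :: "'v vlattice \<Rightarrow> 'v \<Rightarrow> 'v" where
  "abs_val E f = (THE s. is_sup E {f, scal E (- 1) f} s)"

definition lattice_hom :: "'v vlattice \<Rightarrow> 'w vlattice \<Rightarrow> ('v \<Rightarrow> 'w) \<Rightarrow> bool" where
  "lattice_hom E F T \<longleftrightarrow> linear_map E F T \<and> (\<forall>f\<in>carr E. T (abs_val E f) = abs_val F (T f))"

definition lattice_bimorphism ::
  "'v vlattice \<Rightarrow> 'w vlattice \<Rightarrow> 'u vlattice \<Rightarrow> ('v \<Rightarrow> 'w \<Rightarrow> 'u) \<Rightarrow> bool" where
  "lattice_bimorphism E1 E2 F T \<longleftrightarrow>
     (\<forall>f2\<in>carr E2. linear_map E1 F (\<lambda>f1. T f1 f2)) \<and>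
     (\<forall>f1\<in>carr E1. linear_map E2 F (T f1)) \<and>
     (\<forall>f2\<in>pos_cone E2. lattice_hom E1 F (\<lambda>f1. T f1 f2)) \<and>
     (\<forall>f1\<in>pos_cone E1. lattice_hom E2 F (T f1))"

definition square_mean_complete :: "'v vlattice \<Rightarrow> bool" where
  "square_mean_complete E \<longleftrightarrow> (\<forall>f\<in>carr E. \<forall>g\<in>carr E. \<exists>s.
     is_sup E ((\<lambda>\<theta>. add E (scal E (cos \<theta>) f) (scal E (sin \<theta>) g)) ` {0..2 * pi}) s)"


subsection \<open>The Fremlin tensor product\<close>

text \<open>
  HOL cannot quantify over the types of the test lattices \<open>F\<close> inside a formula, so these
  range over all Archimedean vector lattices (with arbitrary carrier and operations) on the type
  \<open>'f\<close>. As a hypothesis, the property for one \<open>'f\<close> is weaker than the property for all types.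
\<close>

definition fremlin_tensor_product ::
  "'f itself \<Rightarrow> 'v vlattice \<Rightarrow> 'w vlattice \<Rightarrow> 'e vlattice \<Rightarrow> ('v \<Rightarrow> 'w \<Rightarrow> 'e) \<Rightarrow> bool" where
  "fremlin_tensor_product (ty :: 'f itself) E1 E2 E tens \<longleftrightarrow>
     archimedean_vector_lattice E \<and> lattice_bimorphism E1 E2 E tens \<and>
     (\<forall>(F :: 'f vlattice) T.
        archimedean_vector_lattice F \<and> lattice_bimorphism E1 E2 F T \<longrightarrow>
        (\<exists>S. (lattice_hom E F S \<and> (\<forall>f1\<in>carr E1. \<forall>f2\<in>carr E2. S (tens f1 f2) = T f1 f2)) \<and>
             (\<forall>S'. lattice_hom E F S' \<and> (\<forall>f1\<in>carr E1. \<forall>f2\<in>carr E2. S' (tens f1 f2) = T f1 f2)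
                    \<longrightarrow> (\<forall>e\<in>carr E. S' e = S e))))"

definition vector_sublattice :: "'v vlattice \<Rightarrow> 'v set \<Rightarrow> bool" where
  "vector_sublattice E W \<longleftrightarrow> vsubspace E W \<and>
     (\<forall>f\<in>W. \<forall>g\<in>W. \<forall>s. is_sup E {f, g} s \<or> is_inf E {f, g} s \<longrightarrow> s \<in> W)"

definition generated_sublattice :: "'v vlattice \<Rightarrow> 'v set \<Rightarrow> 'v vlattice" where
  "generated_sublattice E S = E\<lparr>carr := \<Inter>{W. vector_sublattice E W \<and> S \<subseteq> W}\<rparr>"

definition C_lattice :: "('a::topological_space \<Rightarrow> real) vlattice" where
  "C_lattice = \<lparr>carr = {f. continuous_on UNIV f}, add = (\<lambda>f g x. f x + g x), zer = (\<lambda>x. 0),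
     scal = (\<lambda>a f x. a * f x), le = (\<lambda>f g. \<forall>x. f x \<le> g x)\<rparr>"

definition tensor_fun :: "('a \<Rightarrow> real) \<Rightarrow> ('b \<Rightarrow> real) \<Rightarrow> 'a \<times> 'b \<Rightarrow> real" where
  "tensor_fun f g = (\<lambda>(x, y). f x * g y)"

text \<open>The realisation of the Fremlin tensor product of \<open>C(X)\<close> and \<open>C(Y)\<close> inside \<open>C(X \<times> Y)\<close>.\<close>

definition C_fremlin :: "('a::topological_space \<times> 'b::topological_space \<Rightarrow> real) vlattice" where
  "C_fremlin = generated_sublattice C_lattice
     {tensor_fun f g | f g. f \<in> carr C_lattice \<and> g \<in> carr C_lattice}"


subsection \<open>Archimedean vector lattices over the complex numbers\<close>

text \<open>The pair \<open>(f, g)\<close> stands for \<open>f + i g\<close>.\<close>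

definition complexification :: "'v vlattice \<Rightarrow> (complex, 'v \<times> 'v) vspace" where
  "complexification V = \<lparr>carr = carr V \<times> carr V,
     add = (\<lambda>(f, g) (f', g'). (add V f f', add V g g')),
     zer = (zer V, zer V),
     scal = (\<lambda>c (f, g). (sub V (scal V (Re c) f) (scal V (Im c) g),
                         add V (scal V (Re c) g) (scal V (Im c) f)))\<rparr>"

locale modulus =
  fixes E :: "(complex, 'w) vspace" and m :: "'w \<Rightarrow> 'w"
  assumes m_closed: "m \<in> carr E \<rightarrow> carr E"
    and m_idem: "f \<in> carr E \<Longrightarrow> m (m f) = m f"
    and m_scal: "f \<in> carr E \<Longrightarrow> m (scal E c f) = scal E (of_real (cmod c)) (m f)"
    and m_triangle: "\<lbrakk>f \<in> carr E; g \<in> carr E\<rbrakk> \<Longrightarrow>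
          m (sub E (m (add E (m f) (m g))) (m (add E f g)))
            = sub E (add E (m f) (m g)) (m (add E f g))"
    and m_hull: "linear_hull E (m ` carr E) = carr E"

locale archimedean_modulus = modulus +
  assumes m_archimedean: "\<lbrakk>f \<in> carr E; g \<in> carr E;
          \<And>n::nat. m (sub E (m g) (scal E (of_nat n) (m f))) = sub E (m g) (scal E (of_nat n) (m f))\<rbrakk>
          \<Longrightarrow> f = zer E"

definition complexification_is_archimedean_lattice :: "'v vlattice \<Rightarrow> bool" where
  "complexification_is_archimedean_lattice V \<longleftrightarrow>
     (\<exists>m. archimedean_modulus (complexification V) m \<and>
          m ` carr (complexification V) = (\<lambda>f. (f, zer V)) ` pos_cone V)"

end

theory Submission
  imports Defs
begin

text \<open>
  Let \<open>S\<close> be a lattice homomorphism from \<open>E\<close> to the sublattice \<open>L\<close> of \<open>C(X \<times> Y)\<close> generated by the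
  tensors. Composed with the evaluation at a point it is a real-valued homomorphism \<open>\<phi>\<close>, and both a
  square mean of \<open>f\<close>, \<open>g\<close> and a modulus of \<open>f + i g\<close> are sent by \<open>\<phi>\<close> to \<open>sqrt ((\<phi> f)\<^sup>2 + (\<phi> g)\<^sup>2)\<close>. So either
  of them would put the function \<open>h(x, y) = sqrt (u(x)\<^sup>2 + v(y)\<^sup>2)\<close> into \<open>L\<close>, where \<open>u\<close>, \<open>v\<close> are the distances to
  non-isolated points \<open>x\<^sub>0\<close>, \<open>y\<^sub>0\<close>.

  But every element of \<open>L\<close> takes at each point one of the values of finitely many functions of finite
  rank. By the pigeonhole principle, \<open>h\<close> coincides with one such function on \<open>A \<times> J\<close> with \<open>A\<close>
  accumulating at \<open>x\<^sub>0\<close> and \<open>J\<close> finite but larger than the rank. This gives a nontrivial relation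
  between the functions \<open>a \<mapsto> sqrt (a + v(y)\<^sup>2)\<close>, \<open>y \<in> J\<close>, valid for some \<open>a > 0\<close> arbitrarily near \<open>0\<close>, and
  Rolle's theorem excludes it.
\<close>

subsection \<open>Functions of finite rank\<close>

text \<open>The zeros of \<open>f\<close> accumulate at 0 from the right, so two of them lie below
  any positive bound, and Rolle's theorem puts a zero of \<open>f'\<close> between them.\<close>

lemma frequently_at_right_0_zero_deriv:
  fixes f f' :: "real \<Rightarrow> real"
  assumes zeros: "\<exists>\<^sub>F a in at_right 0. f a = 0"
    and deriv: "\<And>a. a > 0 \<Longrightarrow> (f has_real_derivative f' a) (at a)"
  shows "\<exists>\<^sub>F a in at_right 0. f' a = 0"
  unfolding frequently_def
proof
  have zero_below: "\<exists>a>0. a < e \<and> f a = 0" if "e > 0" for e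
    using zeros that unfolding frequently_def eventually_at_right_field by blast
  assume "\<forall>\<^sub>F a in at_right 0. f' a \<noteq> 0"
  then obtain e where e: "e > 0" "\<And>a. 0 < a \<Longrightarrow> a < e \<Longrightarrow> f' a \<noteq> 0"
    unfolding eventually_at_right_field by blast
  obtain a2 where a2: "a2 > 0" "a2 < e" "f a2 = 0"
    using zero_below e(1) by blast
  obtain a1 where a1: "a1 > 0" "a1 < a2" "f a1 = 0"
    using zero_below a2(1) by blast
  have "\<exists>z>a1. z < a2 \<and> f' z = 0"
  proof -
    have "\<exists>z. a1 < z \<and> z < a2 \<and> (\<lambda>h. h * f' z) = (\<lambda>v. 0)"
    proof (rule Rolle_deriv)
      show "continuous_on {a1..a2} f"
        using deriv a1(1) by (intro DERIV_continuous_on[where D = f'])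
          (auto intro: has_field_derivative_at_within)
      show "(f has_derivative (\<lambda>h. h * f' x)) (at x)" if "a1 < x" "x < a2" for x
        using deriv[of x] that a1(1) unfolding has_field_derivative_def
        by (simp add: mult.commute[of "f' x"] mult_commute_abs)
    qed (use a1 a2 in auto)
    then show ?thesis
      by (metis mult_1)
  qed
  then show False
    using e(2) a1(1) a2(2) by force
qed

text \<open>Dividing the relation by \<open>(a + b i) powr p\<close> makes the summand of
  \<open>i\<close> constant, and differentiation removes it. What remains is a nonvanishing factor
  times a relation of the same shape over \<open>J\<close>, with exponent \<open>p - 1\<close> and
  coefficients \<open>c j * (b i - b j)\<close>. Excluding natural exponents keeps the factor
  \<open>p\<close> nonzero in every round.\<close>

lemma shifted_powr_independent:
  fixes b c :: "'j \<Rightarrow> real"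
  assumes "finite J" "inj_on b J" "\<And>j. j \<in> J \<Longrightarrow> b j \<ge> 0" "p \<notin> \<nat>"
    and "\<exists>\<^sub>F a in at_right 0. (\<Sum>j\<in>J. c j * (a + b j) powr p) = 0"
    and "j \<in> J"
  shows "c j = 0"
  using assms
proof (induction J arbitrary: p c j rule: finite_induct)
  case (insert i J)
  define G where "G = (\<lambda>a. \<Sum>j\<in>insert i J. c j * ((a + b j) powr p * (a + b i) powr - p))"
  define G' where "G' = (\<lambda>a. p * (a + b i) powr (- p - 1) *
      (\<Sum>j\<in>J. (c j * (b i - b j)) * (a + b j) powr (p - 1)))"
  have p: "p \<noteq> 0" "p - 1 \<notin> \<nat>"
    using insert.prems(3) by (auto simp: Nats_def)
       (metis Nats_add Nats_1 Nats_def add.commute diff_add_cancel rangeI)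
  have "\<exists>\<^sub>F a in at_right 0. G a = 0"
  proof (rule frequently_rev_mp[OF insert.prems(4)], rule always_eventually, intro allI impI)
    fix a assume *: "(\<Sum>j\<in>insert i J. c j * (a + b j) powr p) = 0"
    have "G a = (\<Sum>j\<in>insert i J. c j * (a + b j) powr p) * (a + b i) powr - p"
      by (simp only: G_def sum_distrib_right mult.assoc)
    then show "G a = 0"
      using * by simp
  qed
  moreover have "(G has_real_derivative G' a) (at a)" if a: "a > 0" for a
  proof -
    have term_deriv: "((\<lambda>a. c j * ((a + b j) powr p * (a + b i) powr - p)) has_real_derivative
        p * (a + b i) powr (- p - 1) * ((c j * (b i - b j)) * (a + b j) powr (p - 1))) (at a)"
      if "j \<in> insert i J" for j
    proof -
      have pos: "a + b j > 0" "a + b i > 0"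
        using a insert.prems(2) that by (auto intro: add_pos_nonneg)
      \<comment> \<open>Splitting one factor off each power lets both terms of the product rule
        share the exponents \<open>p - 1\<close> and \<open>- p - 1\<close>, so that only
        \<open>b i - b j\<close> is left.\<close>
      have "(a + b j) powr p = (a + b j) powr (p - 1) * (a + b j)"
        "(a + b i) powr - p = (a + b i) powr (- p - 1) * (a + b i)"
        using pos powr_add[of "a + b j" "p - 1" 1] powr_add[of "a + b i" "- p - 1" 1] by auto
      then show ?thesis
        using pos by (auto intro!: derivative_eq_intros simp: algebra_simps)
    qed
    have "(G has_real_derivative (\<Sum>j\<in>insert i J.
        p * (a + b i) powr (- p - 1) * ((c j * (b i - b j)) * (a + b j) powr (p - 1)))) (at a)"
      unfolding G_def by (intro DERIV_sum term_deriv)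
    \<comment> \<open>The summand of \<open>i\<close> drops out through its factor
      \<open>b i - b i\<close>.\<close>
    then show ?thesis
      using insert.hyps by (simp add: G'_def sum_distrib_left)
  qed
  ultimately have "\<exists>\<^sub>F a in at_right 0. G' a = 0"
    by (rule frequently_at_right_0_zero_deriv)
  then have "\<exists>\<^sub>F a in at_right 0. (\<Sum>j\<in>J. (c j * (b i - b j)) * (a + b j) powr (p - 1)) = 0"
  proof (rule frequently_rev_mp)
    show "\<forall>\<^sub>F a in at_right 0. G' a = 0 \<longrightarrow>
        (\<Sum>j\<in>J. (c j * (b i - b j)) * (a + b j) powr (p - 1)) = 0"
      using eventually_at_right_less[of 0]
    proof eventually_elim
      case (elim a)
      then have "a + b i > 0"
        using insert.prems(2) by (auto intro: add_pos_nonneg)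
      then show ?case
        using p by (simp add: G'_def)
    qed
  qed
  then have "c k * (b i - b k) = 0" if "k \<in> J" for k
    using insert.prems(1,2) p that by (intro insert.IH[of "p - 1" "\<lambda>j. c j * (b i - b j)"]) auto
  moreover have "b i - b k \<noteq> 0" if "k \<in> J" for k
    using insert.prems(1) insert.hyps that by (auto simp: inj_on_def)
  ultimately have J0: "c k = 0" if "k \<in> J" for k
    using that by fastforce
  \<comment> \<open>With the other coefficients zero, the original relation at a positive
    \<open>a\<close> is just \<open>c i * (a + b i) powr p = 0\<close>.\<close>
  have "\<exists>\<^sub>F a in at_right (0 :: real). c i = 0"
  proof (rule frequently_rev_mp[OF insert.prems(4)])
    show "\<forall>\<^sub>F a in at_right 0. (\<Sum>j\<in>insert i J. c j * (a + b j) powr p) = 0 \<longrightarrow> c i = 0"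
      using eventually_at_right_less[of 0]
    proof eventually_elim
      case (elim a)
      then have "a + b i > 0"
        using insert.prems(2) by (auto intro: add_pos_nonneg)
      then show ?case
        using J0 insert.hyps by simp
    qed
  qed
  then show ?case
    using J0 insert.prems(5) by (auto simp: frequently_const_iff)
qed auto

text \<open>Gaussian elimination: equation \<open>r\<close> either has only zero coefficients or
  eliminates an unknown \<open>i\<close>, so that one equation and one unknown disappear
  together.\<close>

lemma homogeneous_system_nontrivial_solution:
  fixes q :: "nat \<Rightarrow> 'j \<Rightarrow> real"
  assumes "finite J" "card J > r"
  shows "\<exists>c. (\<exists>j\<in>J. c j \<noteq> 0) \<and> (\<forall>l<r. (\<Sum>j\<in>J. c j * q l j) = 0)"
  using assms
proof (induction r arbitrary: q J)
  case 0
  then obtain j where "j \<in> J"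
    by (auto simp: card_gt_0_iff)
  then show ?case
    by (intro exI[of _ "\<lambda>_. 1"]) auto
next
  case (Suc r)
  show ?case
  proof (cases "\<forall>j\<in>J. q r j = 0")
    case True
    obtain c where "\<exists>j\<in>J. c j \<noteq> 0" "\<forall>l<r. (\<Sum>j\<in>J. c j * q l j) = 0"
      using Suc.IH[OF Suc.prems(1), of q] Suc.prems(2) by auto
    then show ?thesis
      using True by (intro exI[of _ c]) (auto simp: less_Suc_eq)
  next
    case False
    then obtain i where i: "i \<in> J" "q r i \<noteq> 0"
      by blast
    have "r < card (J - {i})"
      using Suc.prems i by simp
    from Suc.IH[OF _ this, of "\<lambda>l j. q l j - q r j / q r i * q l i"] Suc.prems(1)
    obtain c where c: "\<exists>j\<in>J - {i}. c j \<noteq> 0"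
        "\<And>l. l < r \<Longrightarrow> (\<Sum>j\<in>J - {i}. c j * (q l j - q r j / q r i * q l i)) = 0"
      by auto
    \<comment> \<open>\<open>d i\<close> is the value that solves equation \<open>r\<close> for the
      eliminated unknown; substituting it into any equation \<open>l\<close> gives the reduced
      one.\<close>
    define d where "d = c(i := - (\<Sum>j\<in>J - {i}. c j * q r j) / q r i)"
    have d: "(\<Sum>j\<in>J. d j * q l j) = (\<Sum>j\<in>J - {i}. c j * (q l j - q r j / q r i * q l i))" for l
    proof -
      have "(\<Sum>j\<in>J. d j * q l j) = d i * q l i + (\<Sum>j\<in>J - {i}. d j * q l j)"
        by (rule sum.remove[OF Suc.prems(1) i(1)])
      also have "(\<Sum>j\<in>J - {i}. d j * q l j) = (\<Sum>j\<in>J - {i}. c j * q l j)"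
        by (intro sum.cong) (auto simp: d_def)
      also have "d i * q l i + (\<Sum>j\<in>J - {i}. c j * q l j) =
          (\<Sum>j\<in>J - {i}. c j * q l j) - (\<Sum>j\<in>J - {i}. c j * q r j) * (q l i / q r i)"
        by (simp add: d_def)
      also have "\<dots> = (\<Sum>j\<in>J - {i}. c j * (q l j - q r j / q r i * q l i))"
        unfolding sum_distrib_right sum_subtractf[symmetric] by (intro sum.cong) (auto simp: field_simps)
      finally show ?thesis .
    qed
    have "(\<Sum>j\<in>J. d j * q r j) = 0"
      using i(2) by (simp add: d)
    moreover have "\<exists>j\<in>J. d j \<noteq> 0"
      using c(1) by (auto simp: d_def)
    ultimately show ?thesis
      using c(2) d by (intro exI[of _ d]) (auto simp: less_Suc_eq)
  qed
qed

section \<open>Finite rank and pointwise selections\<close>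

definition finite_rank :: "nat \<Rightarrow> ('a \<times> 'b \<Rightarrow> real) \<Rightarrow> bool" where
  "finite_rank r k \<longleftrightarrow> (\<exists>p q. \<forall>x y. k (x, y) = (\<Sum>l<r. p l x * q l y))"

lemma finite_rank_mono:
  assumes "finite_rank r k" "r \<le> s"
  shows "finite_rank s k"
proof -
  obtain p q where "\<forall>x y. k (x, y) = (\<Sum>l<r. p l x * q l y)"
    using assms(1) unfolding finite_rank_def by blast
  moreover have "(\<Sum>l<s. (if l < r then p l x else 0) * q l y) = (\<Sum>l<r. p l x * q l y)" for x y
    using assms(2) by (intro sum.mono_neutral_cong_right) auto
  ultimately show ?thesis
    unfolding finite_rank_def by (intro exI[of _ "\<lambda>l x. if l < r then p l x else 0"] exI[of _ q]) simp
qed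

lemma finite_rank_add:
  assumes "finite_rank r k" "finite_rank s k'"
  shows "finite_rank (r + s) (\<lambda>z. k z + k' z)"
proof -
  obtain p q p' q' where *: "\<forall>x y. k (x, y) = (\<Sum>l<r. p l x * q l y)"
      "\<forall>x y. k' (x, y) = (\<Sum>l<s. p' l x * q' l y)"
    using assms unfolding finite_rank_def by metis
  have split: "(\<Sum>l<r + s. F l) = (\<Sum>l<r. F l) + (\<Sum>l<s. F (r + l))" for F :: "nat \<Rightarrow> real"
    by (induction s) auto
  show ?thesis
    unfolding finite_rank_def
  proof (intro exI allI)
    fix x y
    show "k (x, y) + k' (x, y) = (\<Sum>l<r + s. (if l < r then p l x else p' (l - r) x) *
        (if l < r then q l y else q' (l - r) y))"
      unfolding split *[rule_format] by (intro arg_cong2[where f = "(+)"] sum.cong) auto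
  qed
qed

lemma finite_rank_scale: "finite_rank r k \<Longrightarrow> finite_rank r (\<lambda>z. a * k z)"
  unfolding finite_rank_def
proof (elim exE)
  fix p q
  assume "\<forall>x y. k (x, y) = (\<Sum>l<r. p l x * q l y)"
  then show "\<exists>p q. \<forall>x y. a * k (x, y) = (\<Sum>l<r. p l x * q l y)"
    by (intro exI[of _ "\<lambda>l x. a * p l x"] exI[of _ q]) (simp add: sum_distrib_left mult.assoc)
qed

lemma finite_rank_tensor_fun: "finite_rank 1 (tensor_fun f g)"
  unfolding finite_rank_def tensor_fun_def by (intro exI[of _ "\<lambda>_. f"] exI[of _ "\<lambda>_. g"]) simp

text \<open>The choice of \<open>k\<close> may change from point to point without any regularity.
  This makes the property stable under \<open>max\<close> and \<open>min\<close>, which finite rank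
  itself is not.\<close>

definition finite_rank_covered :: "('a \<times> 'b \<Rightarrow> real) \<Rightarrow> bool" where
  "finite_rank_covered h \<longleftrightarrow> (\<exists>K r. finite K \<and> (\<forall>k\<in>K. finite_rank r k) \<and> (\<forall>z. \<exists>k\<in>K. h z = k z))"

text \<open>A finite range would have a smallest positive value, but \<open>v\<close> takes positive
  values below it arbitrarily near \<open>y\<close>.\<close>

lemma infinite_range_if_tendsto_0:
  fixes v :: "'b::topological_space \<Rightarrow> real"
  assumes "(v \<longlongrightarrow> 0) (at y)" "at y \<noteq> bot" "\<And>z. z \<noteq> y \<Longrightarrow> v z > 0"
  shows "infinite (range v)"
proof
  assume fin: "finite (range v)"
  \<comment> \<open>The element 1 only ensures that the minimum is taken over a nonempty
    set.\<close>
  let ?P = "insert 1 {t \<in> range v. t > 0}"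
  have "Min ?P > 0"
    using fin by simp
  then have "\<forall>\<^sub>F z in at y. v z < Min ?P"
    using order_tendstoD(2)[OF assms(1)] by blast
  moreover have "\<forall>\<^sub>F z in at y. z \<noteq> y"
    by (simp add: eventually_at_filter)
  ultimately have "\<forall>\<^sub>F z in at y. False"
  proof eventually_elim
    case (elim z)
    have "Min ?P \<le> v z"
      using fin assms(3)[OF elim(2)] by (intro Min_le) auto
    then show ?case
      using elim(1) by simp
  qed
  then show False
    using assms(2) by (simp add: trivial_limit_def)
qed

text \<open>The pigeonhole principle is used twice: for fixed \<open>x\<close> it finds more than
  \<open>r\<close> points \<open>y\<close> sharing one \<open>k\<close>, and as \<open>x\<close>
  tends to \<open>x0\<close> it finds one pair \<open>(J, k)\<close> that recurs.\<close>

lemma sqrt_sum_squares_not_finite_rank_covered: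
  fixes u :: "'a::topological_space \<Rightarrow> real" and v :: "'b \<Rightarrow> real"
  assumes u: "(u \<longlongrightarrow> 0) (at x0)" "at x0 \<noteq> bot" "\<And>x. x \<noteq> x0 \<Longrightarrow> u x > 0"
    and v: "infinite (range v)" "\<And>y. v y \<ge> 0"
  shows "\<not> finite_rank_covered (\<lambda>(x, y). sqrt ((u x)\<^sup>2 + (v y)\<^sup>2))"
proof
  assume "finite_rank_covered (\<lambda>(x, y). sqrt ((u x)\<^sup>2 + (v y)\<^sup>2))"
  then obtain K r where K: "finite K" "\<And>k. k \<in> K \<Longrightarrow> finite_rank r k"
      "\<And>x y. \<exists>k\<in>K. sqrt ((u x)\<^sup>2 + (v y)\<^sup>2) = k (x, y)"
    unfolding finite_rank_covered_def by fastforce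
  \<comment> \<open>This is the least size for which a partition into \<open>card K\<close> classes
    forces a class with more than \<open>r\<close> elements. \<open>Y\<close> then takes one
    preimage of each value.\<close>
  obtain V where V: "V \<subseteq> range v" "finite V" "card V = card K * r + 1"
    using infinite_arbitrarily_large[OF v(1)] by metis
  then obtain Y where Y: "inj_on v Y" "v ` Y = V"
    by (metis subset_image_inj)
  have finY: "finite Y" and cardY: "card Y > card K * r"
    using Y V by (auto simp: card_image finite_image_iff)
  define A where "A = {J. J \<subseteq> Y \<and> card J > r} \<times> K"
  have "\<exists>(J, k)\<in>A. \<forall>y\<in>J. sqrt ((u x)\<^sup>2 + (v y)\<^sup>2) = k (x, y)" for x
  proof -
    obtain \<kappa> where \<kappa>: "\<And>y. \<kappa> y \<in> K" "\<And>y. sqrt ((u x)\<^sup>2 + (v y)\<^sup>2) = \<kappa> y (x, y)"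
      using K(3) by metis
    have "\<exists>k\<in>K. card {y \<in> Y. \<kappa> y = k} > r"
    proof (rule ccontr)
      assume "\<not> ?thesis"
      then have "(\<Sum>k\<in>K. card {y \<in> Y. \<kappa> y = k}) \<le> card K * r"
        using sum_bounded_above[of K "\<lambda>k. card {y \<in> Y. \<kappa> y = k}" r] by (simp add: not_less)
      moreover have "(\<Sum>k\<in>K. card {y \<in> Y. \<kappa> y = k}) = card Y"
        using sum_fun_comp[of Y K \<kappa> "\<lambda>_. 1 :: nat"] finY K(1) \<kappa>(1) by (simp add: image_subset_iff)
      ultimately show False
        using cardY by simp
    qed
    then obtain k where "k \<in> K" "card {y \<in> Y. \<kappa> y = k} > r"
      by blast
    then have "({y \<in> Y. \<kappa> y = k}, k) \<in> A" "\<forall>y\<in>{y \<in> Y. \<kappa> y = k}. sqrt ((u x)\<^sup>2 + (v y)\<^sup>2) = k (x, y)"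
      using \<kappa>(2) by (auto simp: A_def)
    then show ?thesis
      by blast
  qed
  then have "\<exists>\<^sub>F x in at x0. \<exists>B\<in>A. \<forall>y\<in>fst B. sqrt ((u x)\<^sup>2 + (v y)\<^sup>2) = snd B (x, y)"
    using u(2) by (intro eventually_frequently always_eventually) (simp_all add: case_prod_beta)
  \<comment> \<open>Since \<open>A\<close> does not depend on \<open>x\<close> and is finite, a
    single pair serves for points arbitrarily near \<open>x0\<close>.\<close>
  moreover have "finite A"
    using finY K(1) by (auto simp: A_def)
  ultimately have "\<exists>B\<in>A. \<exists>\<^sub>F x in at x0. \<forall>y\<in>fst B. sqrt ((u x)\<^sup>2 + (v y)\<^sup>2) = snd B (x, y)"
    using frequently_bex_finite[of A "\<lambda>x B. \<forall>y\<in>fst B. sqrt ((u x)\<^sup>2 + (v y)\<^sup>2) = snd B (x, y)"]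
    by simp
  then obtain B where B: "B \<in> A"
      "\<exists>\<^sub>F x in at x0. \<forall>y\<in>fst B. sqrt ((u x)\<^sup>2 + (v y)\<^sup>2) = snd B (x, y)"
    by blast
  obtain J k where Jk: "B = (J, k)"
    by fastforce
  have J: "J \<subseteq> Y" "card J > r" "finite J" "finite_rank r k"
    using B(1) finY K(2) Jk by (auto simp: A_def intro: finite_subset)
  obtain p q where pq: "\<And>x y. k (x, y) = (\<Sum>l<r. p l x * q l y)"
    using J(4) unfolding finite_rank_def by blast
  \<comment> \<open>More unknowns than equations: some nonzero \<open>c\<close> on \<open>J\<close>
    annihilates every \<open>q l\<close>, and hence \<open>k (x, _)\<close> for every
    \<open>x\<close>.\<close>
  obtain c where c: "\<exists>j\<in>J. c j \<noteq> 0" "\<And>l. l < r \<Longrightarrow> (\<Sum>j\<in>J. c j * q l j) = 0"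
    using homogeneous_system_nontrivial_solution[OF J(3,2), of q] by blast
  have relation: "(\<Sum>y\<in>J. c y * k (x, y)) = 0" for x
  proof -
    have "(\<Sum>y\<in>J. c y * k (x, y)) = (\<Sum>y\<in>J. \<Sum>l<r. p l x * (c y * q l y))"
      by (simp add: pq sum_distrib_left ac_simps)
    also have "\<dots> = (\<Sum>l<r. p l x * (\<Sum>y\<in>J. c y * q l y))"
      by (subst sum.swap) (simp add: sum_distrib_left)
    finally show ?thesis
      by (simp add: c(2))
  qed
  have "\<exists>\<^sub>F x in at x0. (\<Sum>y\<in>J. c y * ((u x)\<^sup>2 + (v y)\<^sup>2) powr (1/2)) = 0"
  proof (rule frequently_rev_mp[OF B(2)], rule always_eventually, intro allI impI)
    fix x assume *: "\<forall>y\<in>fst B. sqrt ((u x)\<^sup>2 + (v y)\<^sup>2) = snd B (x, y)"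
    have "(\<Sum>y\<in>J. c y * ((u x)\<^sup>2 + (v y)\<^sup>2) powr (1/2)) = (\<Sum>y\<in>J. c y * k (x, y))"
      using * Jk by (intro sum.cong) (auto simp: powr_half_sqrt)
    then show "(\<Sum>y\<in>J. c y * ((u x)\<^sup>2 + (v y)\<^sup>2) powr (1/2)) = 0"
      by (simp add: relation)
  qed
  \<comment> \<open>The substitution \<open>a = (u x)\<^sup>2\<close> carries the relation to
    positive \<open>a\<close> tending to 0.\<close>
  moreover have "filterlim (\<lambda>x. (u x)\<^sup>2) (at_right 0) (at x0)"
    unfolding filterlim_at
  proof
    show "\<forall>\<^sub>F x in at x0. (u x)\<^sup>2 \<in> {0<..} \<and> (u x)\<^sup>2 \<noteq> 0"
      unfolding eventually_at_filter using u(3) by (intro always_eventually) force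
    show "((\<lambda>x. (u x)\<^sup>2) \<longlongrightarrow> 0) (at x0)"
      using tendsto_power[OF u(1), of 2] by simp
  qed
  ultimately have "\<exists>\<^sub>F a in at_right 0. (\<Sum>y\<in>J. c y * (a + (v y)\<^sup>2) powr (1/2)) = 0"
    unfolding frequently_def filterlim_iff by blast
  moreover have "inj_on (\<lambda>y. (v y)\<^sup>2) J"
    using Y(1) J(1) v(2) by (auto simp: inj_on_def)
  moreover have "(1/2 :: real) \<notin> \<nat>"
  proof
    assume "(1/2 :: real) \<in> \<nat>"
    then obtain n where "1/2 = real n"
      by (auto elim: Nats_cases)
    then have "real (2 * n) = real 1"
      by simp
    then show False
      unfolding of_nat_eq_iff by presburger
  qed
  ultimately have "c y = 0" if "y \<in> J" for y
    using that J(3) by (intro shifted_powr_independent[where b = "\<lambda>y. (v y)\<^sup>2" and p = "1/2"]) auto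
  then show False
    using c(1) by blast
qed

section \<open>Accumulation points and distance functions\<close>

text \<open>If every point were isolated, the open singletons would cover the compact space, and a
  finite subcover would make it finite.\<close>

lemma exists_non_isolated_point:
  assumes "compact (UNIV :: 'a::topological_space set)" "infinite (UNIV :: 'a set)"
  shows "\<exists>x::'a. at x \<noteq> bot"
proof (rule ccontr)
  assume "\<not> ?thesis"
  then have "\<And>x::'a. open {x}"
    by (simp add: at_eq_bot_iff)
  then obtain C where C: "C \<subseteq> range (\<lambda>x::'a. {x})" "finite C" "UNIV \<subseteq> \<Union>C"
    using compactE[OF assms(1), of "range (\<lambda>x::'a. {x})"] by (metis (no_types, lifting) UN_I UNIV_I imageE singletonI subsetI)
  then have "finite (\<Union>C)"
    by blast
  then show False
    using C(3) assms(2) finite_subset by blast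
qed

text \<open>The witness is the distance to \<open>x0\<close> in a metric that induces the
  topology.\<close>

lemma metrizable_vanishing_function:
  fixes x0 :: "'a::topological_space"
  assumes "metrizable_space (euclidean :: 'a topology)"
  obtains u :: "'a \<Rightarrow> real" where "continuous_on UNIV u" "u x0 = 0" "\<And>x. x \<noteq> x0 \<Longrightarrow> u x > 0"
proof -
  obtain M d where "Metric_space M d" and eq: "(euclidean :: 'a topology) = Metric_space.mtopology M d"
    using assms unfolding metrizable_space_def by blast
  then interpret Metric_space M d
    by simp
  have M: "M = UNIV"
    using eq by (metis topspace_euclidean topspace_mtopology)
  have "continuous_map euclidean euclideanreal (d x0)"
    using continuous_on_mdist[of x0 Self] M mdist_Self mspace_Self unfolding eq mtopology_of_def by simp
  then show ?thesis
    by (intro that[of "d x0"]) (auto simp: M mdist_pos_eq)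
qed

subsection \<open>Real-valued lattice homomorphisms\<close>

context vspace_on
begin

lemma add_left_commute:
  "\<lbrakk>f \<in> carr E; g \<in> carr E; h \<in> carr E\<rbrakk> \<Longrightarrow> add E f (add E g h) = add E g (add E f h)"
  by (metis add_assoc add_commute)

lemma zer_add: "f \<in> carr E \<Longrightarrow> add E (zer E) f = f"
  using add_commute add_zer zer_closed by simp

lemma sub_closed: "\<lbrakk>f \<in> carr E; g \<in> carr E\<rbrakk> \<Longrightarrow> sub E f g \<in> carr E"
  by (simp add: sub_def add_closed scal_closed)

lemma add_sub_cancel: "\<lbrakk>f \<in> carr E; g \<in> carr E\<rbrakk> \<Longrightarrow> add E g (sub E f g) = f"
  using add_left_commute[of g f "scal E (- 1) g"] sub_self[of g] add_zer[of f]
  by (simp add: sub_def scal_closed)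

lemma scal_0: "f \<in> carr E \<Longrightarrow> scal E 0 f = zer E"
  using scal_add_left[of f 1 "- 1"] scal_one[of f] sub_self[of f] by (simp add: sub_def)

lemma scal_zer: "scal E a (zer E) = zer E"
  using scal_scal[OF zer_closed, of a 0] scal_0[OF zer_closed] by simp

lemma sub_zer: "f \<in> carr E \<Longrightarrow> sub E f (zer E) = f"
  by (simp add: sub_def scal_zer add_zer)

end

context real_vector_lattice
begin

lemma is_sup_unique: "\<lbrakk>is_sup E A s; is_sup E A t\<rbrakk> \<Longrightarrow> s = t"
  unfolding is_sup_def by (blast intro: le_antisym)

lemma abs_val_is_sup: "f \<in> carr E \<Longrightarrow> is_sup E {f, scal E (- 1) f} (abs_val E f)"
  unfolding abs_val_def using sup_exists[of f "scal E (- 1) f"]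
  by (metis is_sup_unique scal_closed theI)

lemma abs_val_closed: "f \<in> carr E \<Longrightarrow> abs_val E f \<in> carr E"
  using abs_val_is_sup unfolding is_sup_def by blast

lemma le_abs_val: "f \<in> carr E \<Longrightarrow> le E f (abs_val E f)"
  using abs_val_is_sup unfolding is_sup_def by blast

lemma minus_le_abs_val: "f \<in> carr E \<Longrightarrow> le E (scal E (- 1) f) (abs_val E f)"
  using abs_val_is_sup unfolding is_sup_def by blast

lemma add_mono2:
  assumes "f \<in> carr E" "g \<in> carr E" "f' \<in> carr E" "g' \<in> carr E" "le E f f'" "le E g g'"
  shows "le E (add E f g) (add E f' g')"
proof (rule le_trans[of _ "add E f' g"])
  show "le E (add E f' g) (add E f' g')"
    using add_mono[of g g' f'] assms by (simp add: add_commute)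
qed (use assms add_mono in \<open>auto intro: add_closed\<close>)

text \<open>\<open>c f\<close> is the combination of \<open>f\<close> and \<open>- f\<close> with
  the weights \<open>(r + c) / 2\<close> and \<open>(r - c) / 2\<close>, which are nonnegative and
  sum to \<open>r\<close>.\<close>

lemma scal_le_scal_abs_val:
  assumes f: "f \<in> carr E" and c: "\<bar>c\<bar> \<le> r"
  shows "le E (scal E c f) (scal E r (abs_val E f))"
proof -
  let ?h = "abs_val E f"
  have h: "?h \<in> carr E"
    using f by (rule abs_val_closed)
  have "scal E c f = add E (scal E ((r + c) / 2) f) (scal E ((r - c) / 2) (scal E (- 1) f))"
    using f by (simp add: scal_scal scal_add_left[symmetric] field_simps)
  moreover have "scal E r ?h = add E (scal E ((r + c) / 2) ?h) (scal E ((r - c) / 2) ?h)"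
    using h by (simp add: scal_add_left[symmetric] field_simps)
  moreover have "le E (scal E ((r + c) / 2) f) (scal E ((r + c) / 2) ?h)"
    using c f h by (intro scal_mono le_abs_val) auto
  moreover have "le E (scal E ((r - c) / 2) (scal E (- 1) f)) (scal E ((r - c) / 2) ?h)"
    using c f h by (intro scal_mono minus_le_abs_val scal_closed) auto
  ultimately show ?thesis
    using f h by (auto intro: add_mono2 scal_closed)
qed

lemma sub_nonneg:
  assumes "f \<in> carr E" "g \<in> carr E" "le E f g"
  shows "sub E g f \<in> pos_cone E"
  using add_mono[of f g "scal E (- 1) f"] assms sub_self[of f]
  by (simp add: pos_cone_def sub_def scal_closed add_closed)

lemma abs_val_nonneg_eq:
  assumes "f \<in> pos_cone E"
  shows "abs_val E f = f"
proof -
  have f: "f \<in> carr E" "le E (zer E) f"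
    using assms by (auto simp: pos_cone_def)
  have "le E (scal E (- 1) f) (zer E)"
    using add_mono[of "zer E" f "scal E (- 1) f"] f sub_self[of f]
    by (simp add: sub_def zer_add zer_closed scal_closed)
  then have "le E (scal E (- 1) f) f"
    using f le_trans scal_closed zer_closed by blast
  then have "is_sup E {f, scal E (- 1) f} f"
    using f le_refl by (auto simp: is_sup_def)
  then show ?thesis
    using abs_val_is_sup f(1) is_sup_unique by blast
qed

end

text \<open>Lattice homomorphisms to \<open>\<real>\<close>, stated for \<open>\<phi> :: 'v \<Rightarrow> real\<close> because \<open>\<real>\<close> is not a \<open>vlattice\<close> record.\<close>

locale real_lattice_hom = real_vector_lattice E for E :: "'v vlattice" +
  fixes \<phi> :: "'v \<Rightarrow> real"
  assumes hom_add: "\<lbrakk>f \<in> carr E; g \<in> carr E\<rbrakk> \<Longrightarrow> \<phi> (add E f g) = \<phi> f + \<phi> g"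
    and hom_scal: "f \<in> carr E \<Longrightarrow> \<phi> (scal E a f) = a * \<phi> f"
    and hom_abs_val: "f \<in> carr E \<Longrightarrow> \<phi> (abs_val E f) = \<bar>\<phi> f\<bar>"
begin

lemma hom_zer: "\<phi> (zer E) = 0"
  using hom_add[OF zer_closed zer_closed] add_zer[OF zer_closed] by simp

lemma hom_sub: "\<lbrakk>f \<in> carr E; g \<in> carr E\<rbrakk> \<Longrightarrow> \<phi> (sub E f g) = \<phi> f - \<phi> g"
  by (simp add: sub_def hom_add hom_scal scal_closed)

lemma hom_nonneg: "f \<in> pos_cone E \<Longrightarrow> \<phi> f \<ge> 0"
  using abs_val_nonneg_eq[of f] hom_abs_val[of f] by (simp add: pos_cone_def)

lemma hom_mono: "\<lbrakk>f \<in> carr E; g \<in> carr E; le E f g\<rbrakk> \<Longrightarrow> \<phi> f \<le> \<phi> g"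
  using hom_nonneg[OF sub_nonneg, of f g] hom_sub[of g f] by simp

text \<open>The witness is \<open>|f|\<close> divided by \<open>|\<phi> f|\<close>; its positivity
  is the case \<open>c = 0\<close> of \<open>scal_le_scal_abs_val\<close>.\<close>

lemma exists_hom_eq_1:
  assumes "f \<in> carr E" "\<phi> f \<noteq> 0"
  obtains e where "e \<in> pos_cone E" "\<phi> e = 1"
proof
  let ?e = "scal E (1 / \<bar>\<phi> f\<bar>) (abs_val E f)"
  have "le E (scal E 0 f) ?e"
    using assms(1) by (rule scal_le_scal_abs_val) simp
  then show "?e \<in> pos_cone E"
    using assms(1) by (simp add: pos_cone_def scal_0 scal_closed abs_val_closed)
  show "\<phi> ?e = 1"
    using assms by (simp add: hom_scal hom_abs_val abs_val_closed)
qed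

text \<open>
  With \<open>\<phi> e = 1\<close>, the elements \<open>f' = f - \<phi> f e\<close> and \<open>g' = g - \<phi> g e\<close> lie in the kernel of \<open>\<phi>\<close>, and
  every \<open>f cos \<theta> + g sin \<theta>\<close> is below \<open>r |e| + (|f'| + |g'|)\<close> with \<open>r\<^sup>2 = (\<phi> f)\<^sup>2 + (\<phi> g)\<^sup>2\<close>.
\<close>

lemma hom_square_mean:
  assumes f: "f \<in> carr E" and g: "g \<in> carr E"
    and s: "is_sup E ((\<lambda>\<theta>. add E (scal E (cos \<theta>) f) (scal E (sin \<theta>) g)) ` {0..2 * pi}) s"
  shows "\<phi> s = sqrt ((\<phi> f)\<^sup>2 + (\<phi> g)\<^sup>2)"
proof (cases "\<exists>h\<in>carr E. \<phi> h \<noteq> 0")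
  case False
  then show ?thesis
    using f g s by (simp add: is_sup_def)
next
  case True
  then obtain e where e: "e \<in> carr E" "\<phi> e = 1"
    using exists_hom_eq_1 by (metis (no_types, lifting) mem_Collect_eq pos_cone_def)
  define r where "r = sqrt ((\<phi> f)\<^sup>2 + (\<phi> g)\<^sup>2)"
  define f' g' where "f' = sub E f (scal E (\<phi> f) e)" and "g' = sub E g (scal E (\<phi> g) e)"
  have closed: "f' \<in> carr E" "g' \<in> carr E"
    using f g e by (auto simp: f'_def g'_def sub_closed scal_closed)
  have ker: "\<phi> f' = 0" "\<phi> g' = 0"
    using f g e by (auto simp: f'_def g'_def hom_sub hom_scal scal_closed)
  have fg: "f = add E (scal E (\<phi> f) e) f'" "g = add E (scal E (\<phi> g) e) g'"
    using f g e by (auto simp: f'_def g'_def add_sub_cancel scal_closed)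
  \<comment> \<open>A lattice homomorphism need not preserve infinite suprema. The upper estimate
    comes from this one upper bound of the family, which \<open>\<phi>\<close> sends to exactly
    \<open>r\<close>.\<close>
  define u where "u = add E (scal E r (abs_val E e)) (add E (abs_val E f') (abs_val E g'))"
  have u: "u \<in> carr E" "\<phi> u = r"
    using e closed ker by (auto simp: u_def add_closed scal_closed abs_val_closed hom_add hom_scal hom_abs_val)
  have s': "s \<in> carr E"
    using s by (simp add: is_sup_def)
  have bound: "le E (add E (scal E (cos \<theta>) f) (scal E (sin \<theta>) g)) u" for \<theta>
  proof -
    have "add E (scal E (cos \<theta>) f) (scal E (sin \<theta>) g) =
        add E (scal E (\<phi> f * cos \<theta> + \<phi> g * sin \<theta>) e) (add E (scal E (cos \<theta>) f') (scal E (sin \<theta>) g'))"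
      unfolding scal_add_left[OF e(1)]
      by (subst fg(1), subst fg(2))
        (use e closed in \<open>simp add: scal_add_right scal_scal scal_closed add_closed add_assoc add_left_commute mult.commute\<close>)
    moreover have "\<bar>\<phi> f * cos \<theta> + \<phi> g * sin \<theta>\<bar> \<le> r"
      unfolding r_def
    proof (rule real_le_rsqrt)
      \<comment> \<open>Lagrange's identity, giving the Cauchy-Schwarz inequality in the
        plane.\<close>
      have "(\<phi> f * cos \<theta> + \<phi> g * sin \<theta>)\<^sup>2 + (\<phi> f * sin \<theta> - \<phi> g * cos \<theta>)\<^sup>2 =
          ((\<phi> f)\<^sup>2 + (\<phi> g)\<^sup>2) * ((sin \<theta>)\<^sup>2 + (cos \<theta>)\<^sup>2)"
        by algebra
      then show "\<bar>\<phi> f * cos \<theta> + \<phi> g * sin \<theta>\<bar>\<^sup>2 \<le> (\<phi> f)\<^sup>2 + (\<phi> g)\<^sup>2"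
        using zero_le_power2[of "\<phi> f * sin \<theta> - \<phi> g * cos \<theta>"]
        unfolding power2_abs sin_cos_squared_add mult_1_right by linarith
    qed
    moreover have "le E (scal E (cos \<theta>) f') (abs_val E f')" "le E (scal E (sin \<theta>) g') (abs_val E g')"
      using scal_le_scal_abs_val[of f' "cos \<theta>" 1] scal_le_scal_abs_val[of g' "sin \<theta>" 1] closed
      by (auto simp: scal_one abs_val_closed)
    ultimately show ?thesis
      unfolding u_def using e closed
      by (auto intro!: add_mono2 scal_le_scal_abs_val scal_closed add_closed abs_val_closed)
  qed
  have "\<phi> s \<le> r"
  proof -
    have "le E s u"
      using s u(1) bound by (auto simp: is_sup_def)
    then show ?thesis
      using hom_mono[OF s' u(1)] u(2) by simp
  qed
  moreover have "r \<le> \<phi> s"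
  proof -
    \<comment> \<open>At the polar angle of \<open>z\<close> a single member of the family already
      has the value \<open>r\<close> under \<open>\<phi>\<close>.\<close>
    define z where "z = Complex (\<phi> f) (\<phi> g)"
    obtain \<theta> where \<theta>: "\<theta> \<in> {0..2 * pi}" "\<phi> f = r * cos \<theta>" "\<phi> g = r * sin \<theta>"
    proof
      have "z = complex_of_real r * exp (\<i> * complex_of_real (Arg2pi z))"
        using Arg2pi[of z] by (simp add: z_def r_def complex_norm is_Arg_def)
      also have "\<dots> = complex_of_real r * cis (Arg2pi z)"
        by (simp add: cis_conv_exp)
      finally have "Re z = Re (complex_of_real r * cis (Arg2pi z))" "Im z = Im (complex_of_real r * cis (Arg2pi z))"
        by simp_all
      then show "\<phi> f = r * cos (Arg2pi z)" "\<phi> g = r * sin (Arg2pi z)"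
        by (simp_all add: z_def)
      show "Arg2pi z \<in> {0..2 * pi}"
        using Arg2pi[of z] by simp
    qed
    have "le E (add E (scal E (cos \<theta>) f) (scal E (sin \<theta>) g)) s"
      using s \<theta>(1) by (auto simp: is_sup_def)
    then have "cos \<theta> * \<phi> f + sin \<theta> * \<phi> g \<le> \<phi> s"
      using hom_mono[OF _ s', of "add E (scal E (cos \<theta>) f) (scal E (sin \<theta>) g)"] f g
      by (simp add: hom_add hom_scal scal_closed add_closed)
    moreover have "cos \<theta> * \<phi> f + sin \<theta> * \<phi> g = r * ((cos \<theta>)\<^sup>2 + (sin \<theta>)\<^sup>2)"
      unfolding \<theta>(2,3) by algebra
    ultimately show ?thesis
      by simp
  qed
  ultimately show ?thesis
    by (simp add: r_def)
qed

text \<open>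
  The map \<open>z \<mapsto> \<phi> (m z)\<close> is a complex seminorm that agrees with \<open>|\<phi>|\<close> on the real part \<open>E\<close>. It thus
  vanishes on the complexified kernel of \<open>\<phi>\<close>, a hyperplane, on whose quotient it is the modulus of \<open>\<complex>\<close>.
\<close>

lemma hom_modulus:
  assumes m: "modulus (complexification E) m"
    and range: "m ` carr (complexification E) = (\<lambda>f. (f, zer E)) ` pos_cone E"
    and f: "f \<in> carr E" and g: "g \<in> carr E"
  shows "\<phi> (fst (m (f, g))) = sqrt ((\<phi> f)\<^sup>2 + (\<phi> g)\<^sup>2)"
proof -
  interpret modulus "complexification E" m
    by (rule m)
  let ?C = "complexification E"
  define \<Phi> where "\<Phi> z = Complex (\<phi> (fst z)) (\<phi> (snd z))" for z
  define \<rho> where "\<rho> z = \<phi> (fst (m z))" for z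
  have carr: "(a, b) \<in> carr ?C \<longleftrightarrow> a \<in> carr E \<and> b \<in> carr E" for a b
    by (simp add: complexification_def)
  have add: "add ?C (a, b) (a', b') = (add E a a', add E b b')" for a b a' b'
    by (simp add: complexification_def)
  have scal: "scal ?C c (a, b) = (sub E (scal E (Re c) a) (scal E (Im c) b),
      add E (scal E (Re c) b) (scal E (Im c) a))" for a b c
    by (simp add: complexification_def)
  have C_scal_closed: "scal ?C c z \<in> carr ?C" and \<Phi>_scal: "\<Phi> (scal ?C c z) = c * \<Phi> z"
    if "z \<in> carr ?C" for c z
    using that by (cases z; simp add: \<Phi>_def carr scal add_closed scal_closed sub_closed
        hom_add hom_sub hom_scal complex_eq_iff)+
  have C_add_closed: "add ?C z w \<in> carr ?C" and \<Phi>_add: "\<Phi> (add ?C z w) = \<Phi> z + \<Phi> w"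
    if "z \<in> carr ?C" "w \<in> carr ?C" for z w
    using that by (cases z; cases w; simp add: \<Phi>_def carr add add_closed hom_add complex_eq_iff)+
  have m_range: "\<exists>h\<in>pos_cone E. m z = (h, zer E)" if "z \<in> carr ?C" for z
    using range that by blast
  have \<Phi>_m: "\<Phi> (m z) = of_real (\<rho> z)" and \<rho>_nonneg: "\<rho> z \<ge> 0" if "z \<in> carr ?C" for z
    using m_range[OF that] hom_zer hom_nonneg by (auto simp: \<Phi>_def \<rho>_def complex_eq_iff)
  have m_carr: "m z \<in> carr ?C" if "z \<in> carr ?C" for z
    using m_closed that by blast
  \<comment> \<open>A positive \<open>h\<close> occurs in the range of \<open>m\<close>, and
    \<open>m\<close> is idempotent.\<close>
  have m_pos: "m (h, zer E) = (h, zer E)" if "h \<in> pos_cone E" for h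
    using range that m_idem by (metis (no_types, lifting) imageE imageI)
  have \<rho>_scal: "\<rho> (scal ?C c z) = cmod c * \<rho> z" if "z \<in> carr ?C" for c z
    using \<Phi>_m[OF C_scal_closed[OF that], of c] \<Phi>_m[OF that] m_scal[OF that, of c]
      \<Phi>_scal[OF m_carr[OF that], of "of_real (cmod c)"]
    by (metis of_real_eq_iff of_real_mult)
  have \<rho>_add: "\<rho> (add ?C z w) \<le> \<rho> z + \<rho> w" if z: "z \<in> carr ?C" and w: "w \<in> carr ?C" for z w
  proof -
    \<comment> \<open>By the triangle axiom \<open>m ?v\<close> is
      \<open>m z + m w - m (z + w)\<close>, so \<open>\<Phi>\<close> sends this difference to the
      nonnegative number \<open>\<rho> ?v\<close>.\<close>
    let ?v = "sub ?C (m (add ?C (m z) (m w))) (m (add ?C z w))"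
    have "?v \<in> carr ?C"
      using z w by (simp add: sub_def C_add_closed C_scal_closed m_carr)
    then have "of_real (\<rho> ?v) = \<Phi> (sub ?C (add ?C (m z) (m w)) (m (add ?C z w)))"
      using \<Phi>_m m_triangle[OF z w] by metis
    also have "\<dots> = of_real (\<rho> z + \<rho> w - \<rho> (add ?C z w))"
      using z w by (simp add: sub_def \<Phi>_add \<Phi>_scal C_add_closed C_scal_closed m_carr \<Phi>_m)
    finally have "\<rho> ?v = \<rho> z + \<rho> w - \<rho> (add ?C z w)"
      by (simp only: of_real_eq_iff)
    then show ?thesis
      using \<rho>_nonneg[OF \<open>?v \<in> carr ?C\<close>] by linarith
  qed
  have \<rho>_pos: "\<rho> (h, zer E) = \<phi> h" if "h \<in> pos_cone E" for h
    by (simp add: \<rho>_def m_pos[OF that])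
  have \<rho>_ker: "\<rho> (h, zer E) = 0" if h: "h \<in> carr E" "\<phi> h = 0" for h
  proof -
    let ?a = "abs_val E h"
    \<comment> \<open>These are \<open>|h| + h\<close> and \<open>|h| - h\<close>, with difference
      \<open>2 h\<close>. They are positive, where \<open>\<rho>\<close> is known to agree with
      \<open>\<phi>\<close>, and \<open>\<phi>\<close> vanishes on both.\<close>
    define p q where "p = sub E ?a (scal E (- 1) h)" and "q = sub E ?a h"
    have pq: "p \<in> pos_cone E" "q \<in> pos_cone E"
      unfolding p_def q_def using h by (auto intro!: sub_nonneg le_abs_val minus_le_abs_val abs_val_closed scal_closed)
    then have pq_carr: "p \<in> carr E" "q \<in> carr E"
      by (auto simp: pos_cone_def)
    have "sub E p q = add E (scal E 1 h) (scal E 1 h)"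
      using h sub_self[of ?a] 
      by (simp add: p_def q_def sub_def scal_add_right scal_scal scal_closed abs_val_closed
          add_closed scal_one add_assoc add_left_commute add_commute add_zer)
    then have "scal E 2 h = sub E p q"
      using scal_add_left[OF h(1), of 1 1] by simp
    then have "scal ?C 2 (h, zer E) = add ?C (p, zer E) (scal ?C (- 1) (q, zer E))"
      using h pq_carr by (simp add: add scal scal_0 scal_zer sub_zer add_zer zer_closed scal_closed sub_closed)
        (simp add: sub_def)
    then have "\<rho> (scal ?C 2 (h, zer E)) \<le> \<rho> (p, zer E) + \<rho> (scal ?C (- 1) (q, zer E))"
      using \<rho>_add[of "(p, zer E)" "scal ?C (- 1) (q, zer E)"] pq_carr
      by (simp add: carr zer_closed C_scal_closed)
    then have "2 * \<rho> (h, zer E) \<le> \<phi> p + \<phi> q"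
      using h pq_carr pq by (simp add: \<rho>_scal carr zer_closed \<rho>_pos)
    also have "\<dots> = 0"
      using h by (simp add: p_def q_def hom_sub hom_scal hom_abs_val scal_closed abs_val_closed)
    finally show ?thesis
      using \<rho>_nonneg[of "(h, zer E)"] h(1) by (simp add: carr zer_closed)
  qed
  have le: "\<rho> (a, b) \<le> \<rho> (c, d)" if "a \<in> carr E" "b \<in> carr E" "c \<in> carr E" "d \<in> carr E" "\<phi> a = \<phi> c" "\<phi> b = \<phi> d" for a b c d
  proof -
    \<comment> \<open>The two pairs differ by an element of the complexified kernel, on which
      \<open>\<rho>\<close> vanishes by subadditivity and \<open>\<rho>_ker\<close>.\<close>
    define a' b' where "a' = sub E a c" and "b' = sub E b d"
    have closed: "a' \<in> carr E" "b' \<in> carr E" and ker: "\<phi> a' = 0" "\<phi> b' = 0"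
      using that by (auto simp: a'_def b'_def sub_closed hom_sub)
    let ?w = "add ?C (a', zer E) (scal ?C \<i> (b', zer E))"
    have "?w = (a', b')"
      using closed by (simp add: add scal scal_0 scal_one scal_zer sub_zer add_zer zer_add zer_closed)
    then have "(a, b) = add ?C (c, d) ?w"
      using that by (simp add: add a'_def b'_def add_sub_cancel)
    moreover have "\<rho> ?w \<le> \<rho> (a', zer E) + \<rho> (scal ?C \<i> (b', zer E))"
      using closed by (intro \<rho>_add C_add_closed C_scal_closed) (auto simp: carr zer_closed)
    moreover have "\<rho> (scal ?C \<i> (b', zer E)) = 0"
      using closed ker by (simp add: \<rho>_scal carr zer_closed \<rho>_ker)
    moreover have "\<rho> (a', zer E) = 0"
      using closed ker by (simp add: \<rho>_ker)
    moreover have "\<rho> (add ?C (c, d) ?w) \<le> \<rho> (c, d) + \<rho> ?w"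
      using that closed \<open>?w = (a', b')\<close> by (intro \<rho>_add) (auto simp: carr)
    ultimately show ?thesis
      by simp
  qed
  have "\<rho> (f, g) = sqrt ((\<phi> f)\<^sup>2 + (\<phi> g)\<^sup>2)"
  proof (cases "\<exists>h\<in>carr E. \<phi> h \<noteq> 0")
    case False
    then have "\<phi> f = 0" "\<phi> g = 0" "\<phi> (fst (m (f, g))) = 0"
      using f g m_carr[of "(f, g)"] by (auto simp: carr mem_Times_iff complexification_def)
    then show ?thesis
      by (simp add: \<rho>_def)
  next
    case True
    then obtain e where e: "e \<in> pos_cone E" "\<phi> e = 1"
      using exists_hom_eq_1 by metis
    then have e': "e \<in> carr E"
      by (simp add: pos_cone_def)
    define a b where "a = scal E (\<phi> f) e" and "b = scal E (\<phi> g) e"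
    have ab: "a \<in> carr E" "b \<in> carr E" "\<phi> a = \<phi> f" "\<phi> b = \<phi> g"
      using e e' by (auto simp: a_def b_def scal_closed hom_scal)
    \<comment> \<open>Modulo the kernel, \<open>(f, g)\<close> is a complex multiple of the positive
      element \<open>e\<close>, so homogeneity determines \<open>\<rho>\<close>.\<close>
    have "scal ?C (Complex (\<phi> f) (\<phi> g)) (e, zer E) = (a, b)"
      using e' by (simp add: scal scal_zer sub_zer zer_add scal_closed a_def b_def)
    then have "\<rho> (a, b) = sqrt ((\<phi> f)\<^sup>2 + (\<phi> g)\<^sup>2)"
      using \<rho>_scal[of "(e, zer E)" "Complex (\<phi> f) (\<phi> g)"] e e' \<rho>_pos[of e]
      by (simp add: carr zer_closed complex_norm)
    moreover have "\<rho> (a, b) = \<rho> (f, g)"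
      using le[OF ab(1,2) f g ab(3,4)] le[OF f g ab(1,2)] ab(3,4) by simp
    ultimately show ?thesis
      by simp
  qed
  then show ?thesis
    by (simp add: \<rho>_def)
qed

end

subsection \<open>Vector sublattices of \<open>C(X)\<close>\<close>

lemma C_lattice_simps:
  "carr C_lattice = {f. continuous_on UNIV f}" "add C_lattice = (\<lambda>f g x. f x + g x)"
  "zer C_lattice = (\<lambda>x. 0)" "scal C_lattice = (\<lambda>a f x. a * f x)"
  "le C_lattice = (\<lambda>f g. \<forall>x. f x \<le> g x)"
  by (simp_all add: C_lattice_def)

lemma is_sup_C_lattice:
  assumes "continuous_on UNIV f" "continuous_on UNIV g"
  shows "is_sup C_lattice {f, g} s \<longleftrightarrow> s = (\<lambda>x. max (f x) (g x))"
proof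
  assume *: "is_sup C_lattice {f, g} s"
  have "continuous_on UNIV (\<lambda>x. max (f x) (g x))"
    using assms by (intro continuous_intros)
  with * have "s x \<le> max (f x) (g x)" for x
    by (auto simp: is_sup_def C_lattice_def)
  moreover have "max (f x) (g x) \<le> s x" for x
    using * by (auto simp: is_sup_def C_lattice_def)
  ultimately show "s = (\<lambda>x. max (f x) (g x))"
    by (intro ext antisym)
qed (use assms in \<open>auto simp: is_sup_def C_lattice_def intro!: continuous_intros\<close>)

lemma is_inf_C_lattice:
  assumes "continuous_on UNIV f" "continuous_on UNIV g"
  shows "is_inf C_lattice {f, g} s \<longleftrightarrow> s = (\<lambda>x. min (f x) (g x))"
proof
  assume *: "is_inf C_lattice {f, g} s"
  have "continuous_on UNIV (\<lambda>x. min (f x) (g x))"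
    using assms by (intro continuous_intros)
  with * have "min (f x) (g x) \<le> s x" for x
    by (auto simp: is_inf_def C_lattice_def)
  moreover have "s x \<le> min (f x) (g x)" for x
    using * by (auto simp: is_inf_def C_lattice_def)
  ultimately show "s = (\<lambda>x. min (f x) (g x))"
    by (intro ext antisym)
qed (use assms in \<open>auto simp: is_inf_def C_lattice_def intro!: continuous_intros\<close>)

text \<open>Turns abstract suprema and infima into pointwise \<open>max\<close> and
  \<open>min\<close>. If \<open>W\<close> contains a discontinuous function, both sides are
  false.\<close>

lemma vector_sublattice_C_lattice_iff:
  "vector_sublattice C_lattice W \<longleftrightarrow>
    (\<forall>f\<in>W. continuous_on UNIV f) \<and> (\<lambda>x. 0) \<in> W \<and> (\<forall>f\<in>W. \<forall>g\<in>W. (\<lambda>x. f x + g x) \<in> W) \<and>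
    (\<forall>a. \<forall>f\<in>W. (\<lambda>x. a * f x) \<in> W) \<and>
    (\<forall>f\<in>W. \<forall>g\<in>W. (\<lambda>x. max (f x) (g x)) \<in> W \<and> (\<lambda>x. min (f x) (g x)) \<in> W)"
proof (cases "\<forall>f\<in>W. continuous_on UNIV f")
  case True
  then have "(\<forall>f\<in>W. \<forall>g\<in>W. \<forall>s. is_sup C_lattice {f, g} s \<or> is_inf C_lattice {f, g} s \<longrightarrow> s \<in> W) \<longleftrightarrow>
      (\<forall>f\<in>W. \<forall>g\<in>W. (\<lambda>x. max (f x) (g x)) \<in> W \<and> (\<lambda>x. min (f x) (g x)) \<in> W)"
    by (simp add: is_sup_C_lattice is_inf_C_lattice imp_disjL all_conj_distrib)
  then show ?thesis
    using True by (simp add: vector_sublattice_def vsubspace_def C_lattice_simps subset_iff conj_assoc)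
next
  case False
  then show ?thesis
    unfolding vector_sublattice_def vsubspace_def C_lattice_simps by blast
qed

text \<open>Treats \<open>C_lattice\<close> and \<open>C_fremlin\<close> together.\<close>

locale C_sublattice =
  fixes W :: "('a::topological_space \<Rightarrow> real) set"
  assumes sublattice: "vector_sublattice C_lattice W"
begin

abbreviation L :: "('a \<Rightarrow> real) vlattice" where
  "L \<equiv> C_lattice\<lparr>carr := W\<rparr>"

lemma closed: "(\<lambda>x. 0) \<in> W" "\<lbrakk>f \<in> W; g \<in> W\<rbrakk> \<Longrightarrow> (\<lambda>x. f x + g x) \<in> W"
  "f \<in> W \<Longrightarrow> (\<lambda>x. a * f x) \<in> W" "\<lbrakk>f \<in> W; g \<in> W\<rbrakk> \<Longrightarrow> (\<lambda>x. max (f x) (g x)) \<in> W"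
  "\<lbrakk>f \<in> W; g \<in> W\<rbrakk> \<Longrightarrow> (\<lambda>x. min (f x) (g x)) \<in> W"
  using sublattice unfolding vector_sublattice_C_lattice_iff by simp_all

lemma is_sup_L: "\<lbrakk>f \<in> W; g \<in> W\<rbrakk> \<Longrightarrow> is_sup L {f, g} (\<lambda>x. max (f x) (g x))"
  by (simp add: is_sup_def C_lattice_simps closed)

lemma is_inf_L: "\<lbrakk>f \<in> W; g \<in> W\<rbrakk> \<Longrightarrow> is_inf L {f, g} (\<lambda>x. min (f x) (g x))"
  by (simp add: is_inf_def C_lattice_simps closed)

lemma archimedean: "archimedean_vector_lattice L"
proof unfold_locales
  fix f g :: "'a \<Rightarrow> real"
  assume f: "f \<in> pos_cone L" and "\<And>n::nat. le L (scal L (real n) f) g"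
  then have nf: "real n * f x \<le> g x" and f0: "f x \<ge> 0" for n x
    by (simp_all add: C_lattice_simps pos_cone_def)
  have "f x = 0" for x
  proof (rule ccontr)
    assume "f x \<noteq> 0"
    then have "f x > 0"
      using f0[of x] by simp
    then show False
      using reals_Archimedean3[of "f x"] nf[of _ x] by (meson not_less)
  qed
  then show "f = zer L"
    by (simp add: C_lattice_simps fun_eq_iff)
next
  fix f g h :: "'a \<Rightarrow> real"
  assume "le L f g" "le L g h"
  then show "le L f h"
    by (simp add: C_lattice_simps) (meson order_trans)
next
  fix f g :: "'a \<Rightarrow> real"
  assume "le L f g" "le L g f"
  then show "f = g"
    by (simp add: C_lattice_simps fun_eq_iff order_antisym)
next
  fix f g :: "'a \<Rightarrow> real"
  assume "f \<in> carr L" "g \<in> carr L"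
  then show "\<exists>s. is_sup L {f, g} s" "\<exists>s. is_inf L {f, g} s"
    using is_sup_L[of f g] is_inf_L[of f g] by auto
qed (simp_all add: C_lattice_simps sub_def closed distrib_left distrib_right mult_left_mono fun_eq_iff)

sublocale real_vector_lattice L
  using archimedean by (simp add: archimedean_vector_lattice_def)

lemma abs_val_L: "f \<in> W \<Longrightarrow> abs_val L f = (\<lambda>x. \<bar>f x\<bar>)"
  using is_sup_unique[OF abs_val_is_sup[of f], of "\<lambda>x. max (f x) (- 1 * f x)"]
    is_sup_L[of f "\<lambda>x. - 1 * f x"] closed(3)[of f "- 1"]
  by (simp add: C_lattice_simps fun_eq_iff max_def abs_if)

lemma lattice_hom_closed: "\<lbrakk>lattice_hom E L S; f \<in> carr E\<rbrakk> \<Longrightarrow> S f \<in> W"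
  by (auto simp: lattice_hom_def linear_map_def)

text \<open>The operations of \<open>L\<close> and its absolute value are pointwise, so evaluation
  at \<open>x\<close> preserves them.\<close>

lemma lattice_hom_eval:
  assumes "real_vector_lattice E" "lattice_hom E L S"
  shows "real_lattice_hom E (\<lambda>f. S f x)"
proof -
  have "S f \<in> W" if "f \<in> carr E" for f
    using assms(2) that by (rule lattice_hom_closed)
  moreover have "S (add E f g) = (\<lambda>x. S f x + S g x)" if "f \<in> carr E" "g \<in> carr E" for f g
    using assms(2) that by (simp add: lattice_hom_def linear_map_def C_lattice_simps)
  moreover have "S (scal E a f) = (\<lambda>x. a * S f x)" if "f \<in> carr E" for f a
    using assms(2) that by (simp add: lattice_hom_def linear_map_def C_lattice_simps)
  moreover have "S (abs_val E f) = abs_val L (S f)" if "f \<in> carr E" for f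
    using assms(2) that by (simp add: lattice_hom_def)
  ultimately show ?thesis
    using assms(1) by (intro real_lattice_hom.intro real_lattice_hom_axioms.intro) (simp_all add: abs_val_L)
qed

text \<open>A square mean \<open>s\<close>, or the first component of \<open>m (f, g)\<close>, has
  its image under \<open>S\<close> determined at every point, and this image would be the function
  excluded from \<open>W\<close>. The form with \<open>S\<close> serves both the identity and the
  map given by the universal property.\<close>

lemma lattice_hom_no_square_mean:
  assumes E: "real_vector_lattice E" and S: "lattice_hom E L S"
    and f: "f \<in> carr E" and g: "g \<in> carr E"
    and h: "(\<lambda>x. sqrt ((S f x)\<^sup>2 + (S g x)\<^sup>2)) \<notin> W"
  shows "\<not> square_mean_complete E" "\<not> complexification_is_archimedean_lattice E"
proof -
  note hom = lattice_hom_eval[OF E S]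
  have not_sqrt: "\<exists>x. S s x \<noteq> sqrt ((S f x)\<^sup>2 + (S g x)\<^sup>2)" if "s \<in> carr E" for s
  proof (rule ccontr)
    assume "\<not> ?thesis"
    then have "S s = (\<lambda>x. sqrt ((S f x)\<^sup>2 + (S g x)\<^sup>2))"
      by (simp add: fun_eq_iff)
    then show False
      using h lattice_hom_closed[OF S that] by simp
  qed
  show "\<not> square_mean_complete E"
  proof
    assume "square_mean_complete E"
    then obtain s where s: "is_sup E ((\<lambda>\<theta>. add E (scal E (cos \<theta>) f) (scal E (sin \<theta>) g)) ` {0..2 * pi}) s"
      using f g unfolding square_mean_complete_def by blast
    then have "s \<in> carr E"
      by (simp add: is_sup_def)
    then show False
      using real_lattice_hom.hom_square_mean[OF hom f g s] not_sqrt by blast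
  qed
  show "\<not> complexification_is_archimedean_lattice E"
  proof
    assume "complexification_is_archimedean_lattice E"
    then obtain m where "archimedean_modulus (complexification E) m"
        and range: "m ` carr (complexification E) = (\<lambda>f. (f, zer E)) ` pos_cone E"
      unfolding complexification_is_archimedean_lattice_def by blast
    then have m: "modulus (complexification E) m"
      by (simp add: archimedean_modulus_def)
    have "(f, g) \<in> carr (complexification E)"
      using f g by (simp add: complexification_def)
    then have "m (f, g) \<in> (\<lambda>f. (f, zer E)) ` pos_cone E"
      unfolding range[symmetric] by (rule imageI)
    then have "fst (m (f, g)) \<in> carr E"
      by (auto simp: pos_cone_def)
    then show False
      using real_lattice_hom.hom_modulus[OF hom m range f g] not_sqrt by blast
  qed
qed

end

lemma vector_sublattice_continuous: "vector_sublattice C_lattice {f. continuous_on UNIV f}"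
  unfolding vector_sublattice_C_lattice_iff
  by (simp add: continuous_on_add continuous_on_mult_left continuous_on_max continuous_on_min)

text \<open>Nonemptiness is what yields continuity: the empty intersection consists of all
  functions.\<close>

lemma vector_sublattice_Inter:
  assumes "\<W> \<noteq> {}" "\<And>W. W \<in> \<W> \<Longrightarrow> vector_sublattice C_lattice W"
  shows "vector_sublattice C_lattice (\<Inter>\<W>)"
proof -
  obtain W where W: "W \<in> \<W>"
    using assms(1) by blast
  have *: "\<forall>f\<in>W. continuous_on UNIV f" "(\<lambda>x. 0) \<in> W" "\<forall>f\<in>W. \<forall>g\<in>W. (\<lambda>x. f x + g x) \<in> W"
      "\<forall>a. \<forall>f\<in>W. (\<lambda>x. a * f x) \<in> W"
      "\<forall>f\<in>W. \<forall>g\<in>W. (\<lambda>x. max (f x) (g x)) \<in> W" "\<forall>f\<in>W. \<forall>g\<in>W. (\<lambda>x. min (f x) (g x)) \<in> W"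
    if "W \<in> \<W>" for W
    using assms(2)[OF that] unfolding vector_sublattice_C_lattice_iff by simp_all
  have "\<forall>f\<in>\<Inter>\<W>. continuous_on UNIV f"
    using *(1)[OF W] W by blast
  then show ?thesis
    unfolding vector_sublattice_C_lattice_iff using *(2-6) by simp
qed

lemma continuous_tensor_fun:
  assumes "continuous_on UNIV f" "continuous_on UNIV g"
  shows "continuous_on UNIV (tensor_fun f g)"
  unfolding tensor_fun_def case_prod_beta
  by (intro continuous_on_mult continuous_on_compose2[OF assms(1)] continuous_on_compose2[OF assms(2)]
      continuous_on_fst continuous_on_snd continuous_on_id) auto

subsection \<open>The tensor product of \<open>C(X)\<close> and \<open>C(Y)\<close>\<close>

lemma carr_generated_sublattice:
  "carr (generated_sublattice E S) = \<Inter>{W. vector_sublattice E W \<and> S \<subseteq> W}"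
  by (simp add: generated_sublattice_def)

abbreviation tensors :: "('a::topological_space \<times> 'b::topological_space \<Rightarrow> real) set" where
  "tensors \<equiv> {tensor_fun f g | f g. f \<in> carr C_lattice \<and> g \<in> carr C_lattice}"

lemma tensors_continuous: "tensors \<subseteq> {f. continuous_on UNIV f}"
  by (auto simp: C_lattice_def intro: continuous_tensor_fun)

text \<open>The intersection defining the carrier is over a nonempty family, because the set of all
  continuous functions belongs to it.\<close>

interpretation C_fremlin: C_sublattice
  "carr (C_fremlin :: ('a::topological_space \<times> 'b::topological_space \<Rightarrow> real) vlattice)"
  rewrites "C_lattice\<lparr>carr := carr C_fremlin\<rparr> = C_fremlin"
proof -
  show "C_sublattice (carr (C_fremlin :: ('a \<times> 'b \<Rightarrow> real) vlattice))"
    unfolding C_sublattice_def C_fremlin_def carr_generated_sublattice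
    using vector_sublattice_continuous tensors_continuous by (intro vector_sublattice_Inter) auto
qed (simp add: C_fremlin_def generated_sublattice_def)

interpretation C: C_sublattice "{f :: 'a::topological_space \<Rightarrow> real. continuous_on UNIV f}"
  rewrites "C_lattice\<lparr>carr := {f. continuous_on UNIV f}\<rparr> = C_lattice"
proof -
  show "C_sublattice {f :: 'a \<Rightarrow> real. continuous_on UNIV f}"
    by (simp add: C_sublattice_def vector_sublattice_continuous)
qed (simp add: C_lattice_def)

lemma tensor_fun_in_C_fremlin:
  "\<lbrakk>continuous_on UNIV f; continuous_on UNIV g\<rbrakk> \<Longrightarrow> tensor_fun f g \<in> carr C_fremlin"
  unfolding C_fremlin_def carr_generated_sublattice by (auto simp: C_lattice_simps)

lemma C_fremlin_simps:
  "add C_fremlin = (\<lambda>f g x. f x + g x)" "zer C_fremlin = (\<lambda>x. 0)" "scal C_fremlin = (\<lambda>a f x. a * f x)"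
  by (simp_all add: C_fremlin_def generated_sublattice_def C_lattice_simps)

lemma tensor_fun_linear:
  "tensor_fun (\<lambda>x. f x + f' x) g = (\<lambda>z. tensor_fun f g z + tensor_fun f' g z)"
  "tensor_fun f (\<lambda>y. g y + g' y) = (\<lambda>z. tensor_fun f g z + tensor_fun f g' z)"
  "tensor_fun (\<lambda>x. a * f x) g = (\<lambda>z. a * tensor_fun f g z)"
  "tensor_fun f (\<lambda>y. a * g y) = (\<lambda>z. a * tensor_fun f g z)"
  by (simp_all add: tensor_fun_def fun_eq_iff algebra_simps)

lemma tensor_fun_abs:
  "(\<And>y. g y \<ge> 0) \<Longrightarrow> tensor_fun (\<lambda>x. \<bar>f x\<bar>) g = (\<lambda>z. \<bar>tensor_fun f g z\<bar>)"
  "(\<And>x. f x \<ge> 0) \<Longrightarrow> tensor_fun f (\<lambda>y. \<bar>g y\<bar>) = (\<lambda>z. \<bar>tensor_fun f g z\<bar>)"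
  by (simp_all add: tensor_fun_def fun_eq_iff abs_mult)

text \<open>Makes \<open>C_fremlin\<close> an admissible test lattice for the universal
  property.\<close>

lemma tensor_fun_bimorphism: "lattice_bimorphism C_lattice C_lattice C_fremlin tensor_fun"
proof -
  have linear1: "linear_map C_lattice C_fremlin (\<lambda>f. tensor_fun f g)" if "continuous_on UNIV g" for g :: "'b \<Rightarrow> real"
    using that by (simp add: linear_map_def Pi_iff C_lattice_simps C_fremlin_simps
        tensor_fun_in_C_fremlin tensor_fun_linear)
  have linear2: "linear_map C_lattice C_fremlin (tensor_fun f)" if "continuous_on UNIV f" for f :: "'a \<Rightarrow> real"
    using that by (simp add: linear_map_def Pi_iff C_lattice_simps C_fremlin_simps
        tensor_fun_in_C_fremlin tensor_fun_linear)
  have abs_F: "abs_val C_fremlin (tensor_fun f g) = (\<lambda>z. \<bar>tensor_fun f g z\<bar>)"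
    if "continuous_on UNIV f" "continuous_on UNIV g" for f :: "'a \<Rightarrow> real" and g :: "'b \<Rightarrow> real"
    using that by (intro C_fremlin.abs_val_L tensor_fun_in_C_fremlin)
  have abs_C: "abs_val C_lattice f = (\<lambda>x. \<bar>f x\<bar>)" if "continuous_on UNIV f"
    for f :: "'c::topological_space \<Rightarrow> real"
    using C.abs_val_L[of f] that by simp
  have abs1: "tensor_fun (abs_val C_lattice f) g = abs_val C_fremlin (tensor_fun f g)"
    if "continuous_on UNIV f" "continuous_on UNIV g" "\<forall>y. g y \<ge> 0" for f :: "'a \<Rightarrow> real" and g :: "'b \<Rightarrow> real"
    unfolding abs_F[OF that(1,2)] abs_C[OF that(1)] using that(3) by (intro tensor_fun_abs) simp
  have abs2: "tensor_fun f (abs_val C_lattice g) = abs_val C_fremlin (tensor_fun f g)"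
    if "continuous_on UNIV f" "continuous_on UNIV g" "\<forall>x. f x \<ge> 0" for f :: "'a \<Rightarrow> real" and g :: "'b \<Rightarrow> real"
    unfolding abs_F[OF that(1,2)] abs_C[OF that(2)] using that(3) by (intro tensor_fun_abs) simp
  show ?thesis
    using linear1 linear2 abs1 abs2
    unfolding lattice_bimorphism_def lattice_hom_def pos_cone_def C_lattice_simps by blast
qed

text \<open>
  The functions with values in finitely many finite rank functions form a vector sublattice, since
  finite sets \<open>K\<close>, \<open>K'\<close> for \<open>h\<close>, \<open>h'\<close> give \<open>K \<union> K'\<close> for both \<open>max h h'\<close> and \<open>min h h'\<close>.
\<close>

lemma finite_rank_covered_C_fremlin:
  fixes h :: "'a::topological_space \<times> 'b::topological_space \<Rightarrow> real"
  assumes "h \<in> carr C_fremlin"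
  shows "finite_rank_covered h"
proof -
  let ?W = "{h :: 'a \<times> 'b \<Rightarrow> real. continuous_on UNIV h \<and> finite_rank_covered h}"
  have add: "finite_rank_covered (\<lambda>z. h z + h' z)" if hh: "finite_rank_covered h" "finite_rank_covered h'"
    for h h' :: "'a \<times> 'b \<Rightarrow> real"
  proof -
    obtain K r where K: "finite K" "\<And>k. k \<in> K \<Longrightarrow> finite_rank r k" "\<And>z. \<exists>k\<in>K. h z = k z"
      using hh(1) unfolding finite_rank_covered_def by blast
    obtain K' r' where K': "finite K'" "\<And>k. k \<in> K' \<Longrightarrow> finite_rank r' k" "\<And>z. \<exists>k\<in>K'. h' z = k z"
      using hh(2) unfolding finite_rank_covered_def by blast
    show ?thesis
      unfolding finite_rank_covered_def
    proof (intro exI conjI)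
      show "finite ((\<lambda>(k, k') z. k z + k' z) ` (K \<times> K'))"
        using K(1) K'(1) by simp
      show "\<forall>k\<in>(\<lambda>(k, k') z. k z + k' z) ` (K \<times> K'). finite_rank (r + r') k"
        using K(2) K'(2) by (auto intro: finite_rank_add)
      show "\<forall>z. \<exists>k\<in>(\<lambda>(k, k') z. k z + k' z) ` (K \<times> K'). h z + h' z = k z"
      proof
        fix z
        obtain k k' where "k \<in> K" "h z = k z" "k' \<in> K'" "h' z = k' z"
          using K(3) K'(3) by blast
        then show "\<exists>k\<in>(\<lambda>(k, k') z. k z + k' z) ` (K \<times> K'). h z + h' z = k z"
          by (intro bexI[of _ "\<lambda>z. k z + k' z"]) auto
      qed
    qed
  qed
  have choice: "finite_rank_covered g" if hh: "finite_rank_covered h" "finite_rank_covered h'"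
      "\<And>z. g z = h z \<or> g z = h' z" for g h h' :: "'a \<times> 'b \<Rightarrow> real"
  proof -
    obtain K r where K: "finite K" "\<And>k. k \<in> K \<Longrightarrow> finite_rank r k" "\<And>z. \<exists>k\<in>K. h z = k z"
      using hh(1) unfolding finite_rank_covered_def by blast
    obtain K' r' where K': "finite K'" "\<And>k. k \<in> K' \<Longrightarrow> finite_rank r' k" "\<And>z. \<exists>k\<in>K'. h' z = k z"
      using hh(2) unfolding finite_rank_covered_def by blast
    have "finite (K \<union> K')"
      using K(1) K'(1) by simp
    moreover have "finite_rank (max r r') k" if "k \<in> K \<union> K'" for k
      using that K(2) K'(2) finite_rank_mono[of r k "max r r'"] finite_rank_mono[of r' k "max r r'"] by auto
    moreover have "\<exists>k\<in>K \<union> K'. g z = k z" for z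
      using hh(3)[of z] K(3)[of z] K'(3)[of z] by auto
    ultimately show ?thesis
      unfolding finite_rank_covered_def by (intro exI[of _ "K \<union> K'"] exI[of _ "max r r'"]) simp
  qed
  have max: "finite_rank_covered (\<lambda>z. max (h z) (h' z))" and min: "finite_rank_covered (\<lambda>z. min (h z) (h' z))"
    if "finite_rank_covered h" "finite_rank_covered h'" for h h' :: "'a \<times> 'b \<Rightarrow> real"
    by (rule choice[OF that], simp add: max_def min_def)+
  have scale: "finite_rank_covered (\<lambda>z. a * h z)" if hh: "finite_rank_covered h" for a and h :: "'a \<times> 'b \<Rightarrow> real"
  proof -
    obtain K r where K: "finite K" "\<And>k. k \<in> K \<Longrightarrow> finite_rank r k" "\<And>z. \<exists>k\<in>K. h z = k z"
      using hh unfolding finite_rank_covered_def by blast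
    have "\<forall>k\<in>(\<lambda>k z. a * k z) ` K. finite_rank r k"
      using K(2) finite_rank_scale by blast
    moreover have "\<exists>k\<in>(\<lambda>k z. a * k z) ` K. a * h z = k z" for z
      using K(3)[of z] by (simp add: bex_imageD) metis
    ultimately show ?thesis
      unfolding finite_rank_covered_def using K(1)
      by (intro exI[of _ "(\<lambda>k z. a * k z) ` K"] exI[of _ r]) simp
  qed
  have tens: "finite_rank_covered (tensor_fun f g)" for f :: "'a \<Rightarrow> real" and g :: "'b \<Rightarrow> real"
    unfolding finite_rank_covered_def using finite_rank_tensor_fun
    by (intro exI[of _ "{tensor_fun f g}"] exI[of _ 1]) auto
  have zero: "finite_rank_covered (\<lambda>z :: 'a \<times> 'b. 0)"
    using tens[of "\<lambda>_. 0" "\<lambda>_. 0"] unfolding tensor_fun_def by (simp add: case_prod_unfold)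
  have "vector_sublattice C_lattice ?W"
    unfolding vector_sublattice_C_lattice_iff
    by (simp add: continuous_on_add continuous_on_mult_left continuous_on_max continuous_on_min
        zero add scale max min)
  moreover have "tensors \<subseteq> ?W"
    using tensors_continuous tens by auto
  \<comment> \<open>\<open>?W\<close> is one of the sublattices intersected in the definition of
    \<open>C_fremlin\<close>.\<close>
  ultimately have "carr C_fremlin \<subseteq> ?W"
    unfolding C_fremlin_def carr_generated_sublattice by auto
  then show ?thesis
    using assms by blast
qed

text \<open>The claim covers every pair with the universal property as well as the realisation
  inside \<open>C(X \<times> Y)\<close>. The test lattices live on
  \<open>'a \<times> 'b \<Rightarrow> real\<close> because the property is applied to
  \<open>C_fremlin\<close>. The assertion on the complexification is obtained in parallel with the
  one on square means, from the same missing function.\<close>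

theorem theorem4p11:
  fixes E :: "'e vlattice"
    and tens :: "('a::topological_space \<Rightarrow> real) \<Rightarrow> ('b::topological_space \<Rightarrow> real) \<Rightarrow> 'e"
  assumes "compact (UNIV :: 'a set)" "metrizable_space (euclidean :: 'a topology)"
      "uncountable (UNIV :: 'a set)"
    and "compact (UNIV :: 'b set)" "metrizable_space (euclidean :: 'b topology)"
      "uncountable (UNIV :: 'b set)"
  shows "(fremlin_tensor_product TYPE('a \<times> 'b \<Rightarrow> real) C_lattice C_lattice E tens \<longrightarrow>
            \<not> square_mean_complete E \<and> \<not> complexification_is_archimedean_lattice E) \<and>
         (\<not> square_mean_complete (C_fremlin :: ('a \<times> 'b \<Rightarrow> real) vlattice) \<and>
            \<not> complexification_is_archimedean_lattice (C_fremlin :: ('a \<times> 'b \<Rightarrow> real) vlattice))"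
proof -
  let ?F = "C_fremlin :: ('a \<times> 'b \<Rightarrow> real) vlattice"
  have inf: "infinite (UNIV :: 'a set)" "infinite (UNIV :: 'b set)"
    using assms(3,6) countable_finite by blast+
  obtain x0 :: 'a and y0 :: 'b where pts: "at x0 \<noteq> bot" "at y0 \<noteq> bot"
    using exists_non_isolated_point[OF assms(1) inf(1)] exists_non_isolated_point[OF assms(4) inf(2)] by blast
  obtain u :: "'a \<Rightarrow> real" where u: "continuous_on UNIV u" "u x0 = 0" "\<And>x. x \<noteq> x0 \<Longrightarrow> u x > 0"
    using metrizable_vanishing_function[OF assms(2)] by blast
  obtain v :: "'b \<Rightarrow> real" where v: "continuous_on UNIV v" "v y0 = 0" "\<And>y. y \<noteq> y0 \<Longrightarrow> v y > 0"
    using metrizable_vanishing_function[OF assms(5)] by blast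
  have lim: "(u \<longlongrightarrow> 0) (at x0)" "(v \<longlongrightarrow> 0) (at y0)"
    using u(1,2) v(1,2) unfolding continuous_on_def by (metis UNIV_I)+
  have v0: "v y \<ge> 0" for y
    using v(2,3) by (metis order.strict_implies_order order_refl)
  have "infinite (range v)"
    using infinite_range_if_tendsto_0[OF lim(2) pts(2) v(3)] .
  then have "\<not> finite_rank_covered (\<lambda>(x, y). sqrt ((u x)\<^sup>2 + (v y)\<^sup>2))"
    using sqrt_sum_squares_not_finite_rank_covered[OF lim(1) pts(1) u(3)] v0 by blast
  \<comment> \<open>In tensor notation \<open>f\<close> is \<open>u \<otimes> 1\<close> and
    \<open>g\<close> is \<open>1 \<otimes> v\<close>.\<close>
  moreover define f g where "f = tensor_fun u (\<lambda>y::'b. 1)" and "g = tensor_fun (\<lambda>x::'a. 1) v"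
  moreover have "(\<lambda>z. sqrt ((f z)\<^sup>2 + (g z)\<^sup>2)) = (\<lambda>(x, y). sqrt ((u x)\<^sup>2 + (v y)\<^sup>2))"
    by (simp add: f_def g_def tensor_fun_def fun_eq_iff)
  ultimately have h: "(\<lambda>z. sqrt ((f z)\<^sup>2 + (g z)\<^sup>2)) \<notin> carr ?F"
    using finite_rank_covered_C_fremlin[of "\<lambda>z. sqrt ((f z)\<^sup>2 + (g z)\<^sup>2)"] by auto
  have fg: "f \<in> carr ?F" "g \<in> carr ?F"
    using u v by (auto simp: f_def g_def intro!: tensor_fun_in_C_fremlin)
  have F: "real_vector_lattice ?F" "archimedean_vector_lattice ?F"
    using C_fremlin.archimedean by (auto simp: archimedean_vector_lattice_def)
  have "lattice_hom ?F ?F (\<lambda>h. h)"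
    by (simp add: lattice_hom_def linear_map_def)
  then have "\<not> square_mean_complete ?F" "\<not> complexification_is_archimedean_lattice ?F"
    using C_fremlin.lattice_hom_no_square_mean[OF F(1) _ fg, of "\<lambda>h. h"] h by auto
  moreover have "\<not> square_mean_complete E \<and> \<not> complexification_is_archimedean_lattice E"
    if fremlin: "fremlin_tensor_product TYPE('a \<times> 'b \<Rightarrow> real) C_lattice C_lattice E tens"
  proof -
    have E: "archimedean_vector_lattice E" and tens: "lattice_bimorphism C_lattice C_lattice E tens"
      using fremlin by (auto simp: fremlin_tensor_product_def)
    have "\<forall>(F :: ('a \<times> 'b \<Rightarrow> real) vlattice) T.
        archimedean_vector_lattice F \<and> lattice_bimorphism C_lattice C_lattice F T \<longrightarrow>
        (\<exists>S. lattice_hom E F S \<and> (\<forall>f1\<in>carr C_lattice. \<forall>f2\<in>carr C_lattice. S (tens f1 f2) = T f1 f2))"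
      using fremlin unfolding fremlin_tensor_product_def by fast
    \<comment> \<open>The universal property, applied to \<open>tensor_fun\<close>, maps
      \<open>E\<close> to \<open>C_fremlin\<close>; it sends \<open>tens u 1\<close> and
      \<open>tens 1 v\<close> to \<open>f\<close> and \<open>g\<close>.\<close>
    then obtain S where S: "lattice_hom E ?F S"
        "\<And>f1 f2. f1 \<in> carr C_lattice \<Longrightarrow> f2 \<in> carr C_lattice \<Longrightarrow> S (tens f1 f2) = tensor_fun f1 f2"
      using F(2) tensor_fun_bimorphism by blast
    have carr: "u \<in> carr C_lattice" "v \<in> carr C_lattice"
        "(\<lambda>x::'a. 1) \<in> carr C_lattice" "(\<lambda>y::'b. 1) \<in> carr C_lattice"
      using u v by (auto simp: C_lattice_def)
    have closed: "tens f1 f2 \<in> carr E" if "f1 \<in> carr C_lattice" "f2 \<in> carr C_lattice" for f1 f2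
      using tens that unfolding lattice_bimorphism_def linear_map_def by blast
    have "real_vector_lattice E"
      using E by (rule archimedean_vector_lattice.axioms(1))
    note * = C_fremlin.lattice_hom_no_square_mean[OF this S(1)
        closed[OF carr(1,4)] closed[OF carr(3,2)]]
    show ?thesis
      using * h by (simp add: S(2) carr f_def g_def)
  qed
  ultimately show ?thesis
    by blast
qed

end
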